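(* Let $p$ and $q$ be distinct primes with $\gcd(p-1,q-1)=4$, and let $g,h,D_0,D_1,D_2,D_3$, the polynomials $D_k(X)$, the quaternary sequence $(e_u)$ over $\mathbb{Z}_4$ and $\ell$ be as defined in the context. Let $\beta\in GR(4,4^{\ell})$ be a primitive $pq$-th root of unity. If $p\equiv 5 \pmod 8$ and $q\equiv 5\pmod 8$, then the Mattson-Solomon polynomial $G(X)$ (corresponding to $\beta$) of $(e_u)$ is $$G(X)=2\sum_{j=0}^{p-1}X^{jq}+\sum_{k=0}^{3}(\rho-k)D_k(X),$$ where $\rho=D_1(\beta)+2D_2(\beta)+3D_3(\beta)$.
   Context: $\mathbb{Z}_m=\{0,1,\dots,m-1\}$ is the residue class ring modulo $m$. $p,q$ are distinct primes with $\gcd(p-1,q-1)=4$, and $e=(p-1)(q-1)/4$. Fix an integer $g$ that is a common primitive root of both $p$ and $q$, and an integer $h$ with $h\equiv g\pmod p$, $h\equiv 1\pmod q$. The generalized cyclotomic classes of order $4$ modulo $pq$ are $D_i=\{g^sh^i \bmod pq: s=0,1,\dots,e-1\}\subseteq\{0,\dots,pq-1\}$ for $0\le i<4$; they partition $\mathbb{Z}_{pq}^*$. Put $D_i(X)=\sum_{u\in D_i}X^u\in\mathbb{Z}_4[X]$. Let $P=\{p,2p,\dots,(q-1)p\}$, $Q=\{q,2q,\dots,(p-1)q\}$, $R=\{0\}$. The sequence $(e_u)_{u\ge 0}$ over $\mathbb{Z}_4$ of period $pq$ is: $e_u=2$ if $u\bmod pq\in Q\cup R$; $e_u=0$ if $u\bmod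 pq\in P$; $e_u=i$ if $u\bmod pq\in D_i$, $i=0,1,2,3$. $\ell$ is the multiplicative order of $2$ modulo $pq$. $GR(4,4^r)$ is the Galois ring $\mathbb{Z}_4[X]/(f(X))$ of characteristic $4$ with $4^r$ elements, where $f$ has degree $r$ and is irreducible modulo $2$. A primitive $pq$-th root of unity is a unit of multiplicative order exactly $pq$. Mattson-Solomon polynomial: for a sequence $(s_u)$ over $\mathbb{Z}_4$ of period $T=pq$ and a primitive $T$-th root of unity $\alpha\in GR(4,4^{\ell})$, the Mattson-Solomon polynomial of $(s_u)$ corresponding to $\alpha$ is $G(X)=\sum_{0\le i<T}\rho_iX^i\in GR(4,4^{\ell})[X]$ with $\rho_i=\sum_{0\le u<T}s_u\alpha^{-iu}$; it satisfies $s_u=G(\alpha^u)$ for all $u\ge 0$, and is uniquely determined modulo $X^T-1$ by this property. *)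

theory Defs
  imports
    "HOL-Algebra.Ring_Divisibility"
    "HOL-Number_Theory.Residues"
    "HOL-Number_Theory.Residue_Primitive_Roots"
begin

definition common_primitive_root :: "nat \<Rightarrow> nat \<Rightarrow> int \<Rightarrow> bool" where
  "common_primitive_root p q g \<longleftrightarrow>
     residue_primroot p (nat (g mod int p)) \<and> residue_primroot q (nat (g mod int q))"

definition cyc_class :: "nat \<Rightarrow> nat \<Rightarrow> int \<Rightarrow> int \<Rightarrow> nat \<Rightarrow> nat set" where
  "cyc_class p q g h i =
     {nat ((g ^ s * h ^ i) mod int (p * q)) | s. s < (p - 1) * (q - 1) div 4}"

definition mult_set_P :: "nat \<Rightarrow> nat \<Rightarrow> nat set" where
  "mult_set_P p q = {j * p | j. 1 \<le> j \<and> j \<le> q - 1}"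

definition mult_set_Q :: "nat \<Rightarrow> nat \<Rightarrow> nat set" where
  "mult_set_Q p q = {j * q | j. 1 \<le> j \<and> j \<le> p - 1}"

text \<open>The values lie in \<open>{0..3}\<close>, the carrier of \<open>residue_ring 4\<close>.\<close>

definition quat_seq :: "nat \<Rightarrow> nat \<Rightarrow> int \<Rightarrow> int \<Rightarrow> nat \<Rightarrow> int" where
  "quat_seq p q g h u =
     (if u mod (p * q) \<in> mult_set_Q p q \<union> {0} then 2
      else if u mod (p * q) \<in> mult_set_P p q then 0
      else int (THE i. i < 4 \<and> u mod (p * q) \<in> cyc_class p q g h i))"

abbreviation Z4 :: "int ring" where
  "Z4 \<equiv> residue_ring 4"

text \<open>
  A modulus for the Galois ring: the leading coefficient has to be a unit for the quotient to
  have \<open>4 ^ r\<close> elements. Elements of \<open>UP R\<close> are the coefficient functions themselves, so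
  \<open>\<lambda>n. f n mod 2\<close> is the reduction of \<open>f\<close> modulo 2.
\<close>

definition galois_modulus :: "nat \<Rightarrow> (nat \<Rightarrow> int) \<Rightarrow> bool" where
  "galois_modulus r f \<longleftrightarrow>
     f \<in> carrier (UP Z4) \<and> deg Z4 f = r \<and> coeff (UP Z4) f r \<in> Units Z4 \<and>
     ring_irreducible\<^bsub>UP (residue_ring 2)\<^esub> (\<lambda>n. f n mod 2)"

definition galois_ring4 :: "(nat \<Rightarrow> int) \<Rightarrow> (nat \<Rightarrow> int) set ring" where
  "galois_ring4 f = UP Z4 Quot (PIdl\<^bsub>UP Z4\<^esub> f)"

definition primitive_unity_root :: "('a, 'm) ring_scheme \<Rightarrow> nat \<Rightarrow> 'a \<Rightarrow> bool" where
  "primitive_unity_root R n x \<longleftrightarrow> x \<in> Units R \<and> group.ord (units_of R) x = n"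

text \<open>
  \<open>\<Sum>\<^sub>u\<^sub>\<in>\<^sub>A X\<^sup>u\<close> over an arbitrary coefficient ring \<open>R\<close>: for \<open>R = Z4\<close> and a class \<open>A = D\<^sub>k\<close> this is
  \<open>D\<^sub>k(X)\<close>, and for a Galois ring \<open>R\<close> it is the image of \<open>D\<^sub>k(X)\<close> under the canonical map
  from \<open>Z4\<close>.
\<close>

definition set_poly :: "('a, 'm) ring_scheme \<Rightarrow> nat set \<Rightarrow> nat \<Rightarrow> 'a" where
  "set_poly R A = (\<Oplus>\<^bsub>UP R\<^esub>u\<in>A. monom (UP R) \<one>\<^bsub>R\<^esub> u)"

text \<open>
  A sequence over \<open>Z4\<close> acts on a ring of characteristic 4 by integer multiples. The negative
  power is meaningful because \<open>\<alpha>\<close> is a unit of \<open>R\<close> in all uses.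
\<close>

definition ms_coeff ::
    "('a, 'm) ring_scheme \<Rightarrow> nat \<Rightarrow> (nat \<Rightarrow> int) \<Rightarrow> 'a \<Rightarrow> nat \<Rightarrow> 'a" where
  "ms_coeff R T s \<alpha> i = (\<Oplus>\<^bsub>R\<^esub>u\<in>{..<T}. [s u] \<cdot>\<^bsub>R\<^esub> (\<alpha> [^]\<^bsub>R\<^esub> (- int (i * u))))"

definition mattson_solomon ::
    "('a, 'm) ring_scheme \<Rightarrow> nat \<Rightarrow> (nat \<Rightarrow> int) \<Rightarrow> 'a \<Rightarrow> nat \<Rightarrow> 'a" where
  "mattson_solomon R T s \<alpha> = (\<Oplus>\<^bsub>UP R\<^esub>i\<in>{..<T}. monom (UP R) (ms_coeff R T s \<alpha> i) i)"

end

theory Submission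
  imports Defs
begin

text \<open>
  The Galois ring is local with maximal ideal generated by 2, and \<open>(1 + 2 c)\<^sup>2 = 1\<close> because 4 vanishes
  in it. Hence a root of unity \<open>\<zeta> \<noteq> 1\<close> of odd order is not congruent to 1 modulo 2, so \<open>\<zeta> - 1\<close> is a unit
  and the powers of \<open>\<zeta>\<close> sum to 0.

  The exponent of \<open>\<beta>\<close> in the coefficient \<open>\<rho>\<^sub>i\<close> runs over the classes \<open>w D\<^sub>k\<close> with \<open>w = - i\<close>; to stay
  within the natural numbers, \<open>- 1\<close> is represented by \<open>p q - 1\<close>. Taking discrete
  logarithms \<open>a\<close> modulo \<open>q\<close> and \<open>b\<close> modulo \<open>p\<close>, a unit lies in \<open>D\<^sub>k\<close> iff \<open>b - a \<equiv> k\<close> modulo 4. So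
  \<open>D\<^sub>j D\<^sub>k = D\<^sub>j\<^sub>+\<^sub>k\<close>, and \<open>- 1 \<in> D\<^sub>0\<close> because both of its logarithms are 2 modulo 4; for \<open>i \<in> D\<^sub>j\<close> the sums
  over the classes are merely permuted, and their total is 1. If \<open>i\<close> is divisible by exactly one of \<open>p\<close>
  and \<open>q\<close>, the reduction of each \<open>D\<^sub>k\<close> modulo the other prime covers every nonzero residue an odd
  number of times, so that \<open>\<rho>\<^sub>i\<close> only depends on a parity.
\<close>

section \<open>Galois rings of characteristic 4\<close>

text \<open>Applied below to reduction modulo 2, which thus becomes a homomorphism from Z4[X] to
  F2[X].\<close>

lemma map_UP_ring_hom:
  assumes "cring R" "cring S" "h \<in> ring_hom R S"
  shows "(\<lambda>p n. h (p n)) \<in> ring_hom (UP R) (UP S)"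
proof -
  interpret ring_hom_cring R S h
    using assms by (simp add: ring_hom_cring_def ring_hom_cring_axioms_def)
  have up: "(\<lambda>n. h (p n)) \<in> up S" if p: "p \<in> up R" for p
  proof -
    obtain m where "bound \<zero>\<^bsub>R\<^esub> m p" using p by (auto simp: up_def)
    then have "bound \<zero>\<^bsub>S\<^esub> m (\<lambda>n. h (p n))" by (auto simp: bound_def)
    then show ?thesis using p by (auto simp: up_def Pi_def)
  qed
  show ?thesis
  proof (rule ring_hom_memI)
    fix x y assume x: "x \<in> carrier (UP R)" and y: "y \<in> carrier (UP R)"
    then have xy: "x \<in> up R" "y \<in> up R" by (auto simp: UP_def)
    show "(\<lambda>n. h (x n)) \<in> carrier (UP S)"
      using up[OF xy(1)] by (simp add: UP_def)
    show "(\<lambda>n. h ((x \<otimes>\<^bsub>UP R\<^esub> y) n)) = (\<lambda>n. h (x n)) \<otimes>\<^bsub>UP S\<^esub> (\<lambda>n. h (y n))"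
    proof
      fix n
      have "h (\<Oplus>\<^bsub>R\<^esub>i\<in>{..n}. x i \<otimes>\<^bsub>R\<^esub> y (n - i))
          = (\<Oplus>\<^bsub>S\<^esub>i\<in>{..n}. (h \<circ> (\<lambda>i. x i \<otimes>\<^bsub>R\<^esub> y (n - i))) i)"
        using xy by (subst hom_finsum) (auto simp: mem_upD)
      also have "\<dots> = (\<Oplus>\<^bsub>S\<^esub>i\<in>{..n}. h (x i) \<otimes>\<^bsub>S\<^esub> h (y (n - i)))"
        using xy by (intro S.finsum_cong') (auto simp: mem_upD)
      finally show "h ((x \<otimes>\<^bsub>UP R\<^esub> y) n) = ((\<lambda>n. h (x n)) \<otimes>\<^bsub>UP S\<^esub> (\<lambda>n. h (y n))) n"
        using xy up by (simp add: UP_def)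
    qed
    show "(\<lambda>n. h ((x \<oplus>\<^bsub>UP R\<^esub> y) n)) = (\<lambda>n. h (x n)) \<oplus>\<^bsub>UP S\<^esub> (\<lambda>n. h (y n))"
      using xy up by (auto simp: UP_def mem_upD)
  next
    show "(\<lambda>n. h (\<one>\<^bsub>UP R\<^esub> n)) = \<one>\<^bsub>UP S\<^esub>"
      by (auto simp: UP_def)
  qed
qed

text \<open>Pseudo-division leaves a power of the leading coefficient of the divisor in front of the
  dividend. Over a field that power is a unit and can be divided out, so the degree is a Euclidean
  function. The consequence of interest is that an irreducible polynomial over F2 generates a
  maximal ideal.\<close>

lemma field_UP_principal_domain:
  assumes "field F"
  shows "principal_domain (UP F)"
proof -
  interpret F: field F by fact
  interpret UP_domain F "UP F"
    by (simp add: UP_domain_def F.domain_axioms)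
  have "euclidean_domain (UP F) (deg F)"
  proof (rule domain.euclidean_domainI[OF UP_domain])
    fix a b assume a: "a \<in> carrier (UP F) - {\<zero>\<^bsub>UP F\<^esub>}" and b: "b \<in> carrier (UP F) - {\<zero>\<^bsub>UP F\<^esub>}"
    let ?c = "coeff (UP F) b (deg F b)"
    obtain q r k where qr: "q \<in> carrier (UP F)" "r \<in> carrier (UP F)"
      "?c [^]\<^bsub>F\<^esub> (k::nat) \<odot>\<^bsub>UP F\<^esub> a = b \<otimes>\<^bsub>UP F\<^esub> q \<oplus>\<^bsub>UP F\<^esub> r"
      "r = \<zero>\<^bsub>UP F\<^esub> \<or> deg F r < deg F b"
      using long_div_theorem[of b a] a b by auto
    have "?c \<in> Units F"
      using b lcoeff_nonzero2[of b] by (simp add: F.field_Units)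
    then have cu: "?c [^]\<^bsub>F\<^esub> k \<in> Units F" by (rule F.Units_pow_closed)
    define d where "d = inv\<^bsub>F\<^esub> (?c [^]\<^bsub>F\<^esub> k)"
    have d: "d \<in> carrier F" "d \<otimes>\<^bsub>F\<^esub> ?c [^]\<^bsub>F\<^esub> k = \<one>\<^bsub>F\<^esub>" "d \<noteq> \<zero>\<^bsub>F\<^esub>"
      using cu F.Units_inv_closed F.Units_l_inv F.Units_inv_Units[OF cu] unfolding d_def
      by (auto simp: F.field_Units)
    have "a = (d \<otimes>\<^bsub>F\<^esub> ?c [^]\<^bsub>F\<^esub> k) \<odot>\<^bsub>UP F\<^esub> a"
      using a d by simp
    also have "\<dots> = d \<odot>\<^bsub>UP F\<^esub> (b \<otimes>\<^bsub>UP F\<^esub> q \<oplus>\<^bsub>UP F\<^esub> r)"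
      using a d(1) F.Units_closed[OF cu] by (simp only: UP_smult_assoc1 qr(3)[symmetric] Diff_iff)
    also have "\<dots> = b \<otimes>\<^bsub>UP F\<^esub> (d \<odot>\<^bsub>UP F\<^esub> q) \<oplus>\<^bsub>UP F\<^esub> (d \<odot>\<^bsub>UP F\<^esub> r)"
      using a b d qr by (simp add: UP_smult_r_distr smult_assoc2 P.m_comm[of b])
    finally have "a = b \<otimes>\<^bsub>UP F\<^esub> (d \<odot>\<^bsub>UP F\<^esub> q) \<oplus>\<^bsub>UP F\<^esub> (d \<odot>\<^bsub>UP F\<^esub> r)" .
    moreover have "d \<odot>\<^bsub>UP F\<^esub> r = \<zero>\<^bsub>UP F\<^esub> \<or> deg F (d \<odot>\<^bsub>UP F\<^esub> r) < deg F b"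
      using qr d by auto
    ultimately show "\<exists>q r. q \<in> carrier (UP F) \<and> r \<in> carrier (UP F) \<and>
        a = b \<otimes>\<^bsub>UP F\<^esub> q \<oplus>\<^bsub>UP F\<^esub> r \<and> (r = \<zero>\<^bsub>UP F\<^esub> \<or> deg F r < deg F b)"
      using d qr by (intro exI[of _ "d \<odot>\<^bsub>UP F\<^esub> q"] exI[of _ "d \<odot>\<^bsub>UP F\<^esub> r"]) auto
  qed
  then interpret euclidean_domain "UP F" "deg F" .
  show ?thesis by (rule principal_domain_axioms)
qed

lemma mod2_ring_hom: "(\<lambda>x. x mod 2) \<in> ring_hom Z4 (residue_ring 2)"
proof -
  have "x mod 4 mod 2 = x mod 2" for x :: int by (simp add: mod_mod_cancel)
  then show ?thesis
    by (intro ring_hom_memI) (auto simp: residue_ring_def mod_mult_eq mod_add_eq)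
qed

text \<open>The kernel of reduction modulo 2 is generated by 2. Coefficients are representatives in
  0..3, so the integer half of an even one is again such a representative.\<close>

lemma even_UP_Z4:
  assumes c: "c \<in> carrier (UP Z4)" and e: "\<And>n. c n mod 2 = 0"
  shows "\<exists>d\<in>carrier (UP Z4). c = d \<oplus>\<^bsub>UP Z4\<^esub> d"
proof (intro bexI)
  have c': "c \<in> up Z4" using c by (simp add: UP_def)
  have rng: "0 \<le> c n" "c n < 4" for n
    using mem_upD[OF c', of n] by (auto simp: residue_ring_def)
  obtain m where m: "bound 0 m c" using c' by (auto simp: up_def residue_ring_def)
  show d: "(\<lambda>n. c n div 2) \<in> carrier (UP Z4)"
  proof -
    have "bound 0 m (\<lambda>n. c n div 2)" using m by (auto simp: bound_def)
    moreover have "c n div 2 \<in> {0..3}" for n using rng[of n] by auto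
    ultimately show ?thesis by (auto simp: UP_def up_def residue_ring_def)
  qed
  have "c n = (c n div 2 + c n div 2) mod 4" for n
    using rng[of n] e[of n] by presburger
  then show "c = (\<lambda>n. c n div 2) \<oplus>\<^bsub>UP Z4\<^esub> (\<lambda>n. c n div 2)"
    using d by (auto simp: UP_def residue_ring_def)
qed

lemma residue_ring_2_field: "field (residue_ring 2)"
proof -
  interpret residues_prime 2 "residue_ring 2"
    by unfold_locales auto
  show ?thesis by (rule is_field)
qed

text \<open>The square is 1 + 4 (c^2 + c). This serves twice: it makes every element congruent to 1
  modulo 2 a unit, and it bounds the order of a root of unity congruent to 1 modulo 2.\<close>

lemma (in cring) double_plus_one_square:
  assumes four: "\<And>x. x \<in> carrier R \<Longrightarrow> (x \<oplus> x) \<oplus> (x \<oplus> x) = \<zero>" and c: "c \<in> carrier R"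
  shows "(c \<oplus> c \<oplus> \<one>) \<otimes> (c \<oplus> c \<oplus> \<one>) = \<one>"
proof -
  let ?d = "c \<otimes> c \<oplus> c"
  have "(c \<oplus> c \<oplus> \<one>) \<otimes> (c \<oplus> c \<oplus> \<one>) = (?d \<oplus> ?d) \<oplus> (?d \<oplus> ?d) \<oplus> \<one>"
    using c by algebra
  also have "\<dots> = \<one>" using four[of ?d] c by simp
  finally show ?thesis .
qed

lemma (in cring) double_plus_one_unit:
  assumes "\<And>x. x \<in> carrier R \<Longrightarrow> (x \<oplus> x) \<oplus> (x \<oplus> x) = \<zero>" and "c \<in> carrier R"
  shows "c \<oplus> c \<oplus> \<one> \<in> Units R"
proof -
  have "c \<oplus> c \<oplus> \<one> \<in> carrier R" using assms(2) by simp
  with double_plus_one_square[OF assms] show ?thesis unfolding Units_def by blast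
qed

lemma galois_ring4_cring:
  assumes "galois_modulus r f"
  shows "cring (galois_ring4 f)"
proof -
  interpret Z: residues 4 Z4 by unfold_locales auto
  interpret UP_cring Z4 "UP Z4" by (simp add: UP_cring_def Z.cring)
  show ?thesis
    unfolding galois_ring4_def using assms
    by (intro ideal.quotient_is_cring P.cgenideal_ideal P.is_cring)
       (simp add: galois_modulus_def)
qed

text \<open>The residue field is K = F2[X] / (f mod 2), and \<open>\<Psi>\<close> is the map from
  Z4[X] onto it. A representative with image zero in K yields an element of 2R. One with nonzero
  image has an inverse modulo 2, and the product with a lift of that inverse has the form 1 + 2c,
  hence is a unit.\<close>

lemma galois_ring4_char_and_local:
  assumes gm: "galois_modulus r f"
  defines "R \<equiv> galois_ring4 f"
  shows "x \<in> carrier R \<Longrightarrow> (x \<oplus>\<^bsub>R\<^esub> x) \<oplus>\<^bsub>R\<^esub> (x \<oplus>\<^bsub>R\<^esub> x) = \<zero>\<^bsub>R\<^esub>"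
    and "x \<in> carrier R \<Longrightarrow> x \<in> Units R \<or> (\<exists>c\<in>carrier R. x = c \<oplus>\<^bsub>R\<^esub> c)"
proof -
  interpret Z: residues 4 Z4 by unfold_locales auto
  interpret Z2: field "residue_ring 2" by (rule residue_ring_2_field)
  interpret P4: UP_cring Z4 "UP Z4" by (simp add: UP_cring_def Z.cring)
  interpret P2: principal_domain "UP (residue_ring 2)"
    by (rule field_UP_principal_domain[OF residue_ring_2_field])
  interpret R: cring R unfolding R_def by (rule galois_ring4_cring[OF gm])
  define I where "I = PIdl\<^bsub>UP Z4\<^esub> f"
  define f2 where "f2 = (\<lambda>n. f n mod 2)"
  have fc: "f \<in> carrier (UP Z4)" using gm by (simp add: galois_modulus_def)
  interpret I: ideal I "UP Z4" unfolding I_def by (rule P4.P.cgenideal_ideal[OF fc])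
  interpret \<pi>: ring_hom_ring "UP Z4" R "(+>\<^bsub>UP Z4\<^esub>) I"
    unfolding R_def galois_ring4_def I_def[symmetric] by (rule I.rcos_ring_hom_ring)
  let ?red = "\<lambda>a n. a n mod (2::int)"
  interpret red: ring_hom_cring "UP Z4" "UP (residue_ring 2)" ?red
    using map_UP_ring_hom[OF Z.cring Z2.is_cring mod2_ring_hom] P4.P.is_cring P2.is_cring
    by (simp add: ring_hom_cring_def ring_hom_cring_axioms_def)
  have f2c: "f2 \<in> carrier (UP (residue_ring 2))" unfolding f2_def using fc by (rule red.hom_closed)
  have max: "maximalideal (PIdl\<^bsub>UP (residue_ring 2)\<^esub> f2) (UP (residue_ring 2))"
    using gm f2c by (intro P2.irreducible_imp_maximalideal) (auto simp: galois_modulus_def f2_def)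
  define M where "M = PIdl\<^bsub>UP (residue_ring 2)\<^esub> f2"
  interpret M: maximalideal M "UP (residue_ring 2)" unfolding M_def by (rule max)
  define K where "K = UP (residue_ring 2) Quot M"
  interpret K: field K unfolding K_def by (rule M.quotient_is_field[OF P2.is_cring])
  interpret \<kappa>: ring_hom_ring "UP (residue_ring 2)" K "(+>\<^bsub>UP (residue_ring 2)\<^esub>) M"
    unfolding K_def by (rule M.rcos_ring_hom_ring)
  define \<Psi> where "\<Psi> a = M +>\<^bsub>UP (residue_ring 2)\<^esub> (?red a)" for a
  have \<Psi>hom: "\<Psi> \<in> ring_hom (UP Z4) K"
    unfolding \<Psi>_def by (intro ring_hom_memI) auto
  interpret \<Psi>: ring_hom_cring "UP Z4" K \<Psi>
    using \<Psi>hom P4.P.is_cring K.is_cring by (simp add: ring_hom_cring_def ring_hom_cring_axioms_def)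
  \<comment> \<open>A 0-1 coefficient function over F2 is reread unchanged as a polynomial over
    Z4.\<close>
  have lift: "\<exists>a\<in>carrier (UP Z4). ?red a = b" if b: "b \<in> carrier (UP (residue_ring 2))" for b
  proof -
    have b': "b n \<in> {0..1}" for n
      using mem_upD[of b "residue_ring 2" n] b by (simp add: UP_def residue_ring_def)
    obtain m where "bound 0 m b" using b by (auto simp: UP_def up_def residue_ring_def)
    then have "b \<in> carrier (UP Z4)" using b' by (fastforce simp: UP_def up_def residue_ring_def)
    moreover have "b n mod 2 = b n" for n
      using b'[of n] by auto
    then have "?red b = b" by blast
    ultimately show ?thesis by blast
  qed
  have surj_\<pi>: "\<exists>a\<in>carrier (UP Z4). x = I +>\<^bsub>UP Z4\<^esub> a" if "x \<in> carrier R" for x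
    using that unfolding R_def galois_ring4_def I_def[symmetric]
    by (auto simp: FactRing_simps)
  have surj_\<Psi>: "\<exists>a\<in>carrier (UP Z4). x = \<Psi> a" if x: "x \<in> carrier K" for x
  proof -
    obtain b where "b \<in> carrier (UP (residue_ring 2))" "x = M +>\<^bsub>UP (residue_ring 2)\<^esub> b"
      using x unfolding K_def by (auto simp: FactRing_simps)
    then show ?thesis using lift[of b] unfolding \<Psi>_def by blast
  qed
  have \<pi>f: "I +>\<^bsub>UP Z4\<^esub> (v \<otimes>\<^bsub>UP Z4\<^esub> f) = \<zero>\<^bsub>R\<^esub>" if "v \<in> carrier (UP Z4)" for v
  proof -
    have "v \<otimes>\<^bsub>UP Z4\<^esub> f \<in> I" using that unfolding I_def cgenideal_def by blast
    then have "I +>\<^bsub>UP Z4\<^esub> (v \<otimes>\<^bsub>UP Z4\<^esub> f) = I" by (rule I.a_rcos_const)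
    then show ?thesis unfolding R_def galois_ring4_def I_def[symmetric] by (simp add: FactRing_def)
  qed
  \<comment> \<open>The kernel of \<open>\<Psi>\<close> is generated by f and 2: after subtraction
    of a lifted multiple of f, every coefficient is even, and the multiple of f vanishes in
    R.\<close>
  have double: "\<exists>c\<in>carrier R. I +>\<^bsub>UP Z4\<^esub> a = c \<oplus>\<^bsub>R\<^esub> c"
    if a: "a \<in> carrier (UP Z4)" and z: "\<Psi> a = \<zero>\<^bsub>K\<^esub>" for a
  proof -
    have ra: "?red a \<in> carrier (UP (residue_ring 2))" using a by (rule red.hom_closed)
    have "M +>\<^bsub>UP (residue_ring 2)\<^esub> ?red a = M"
      using z unfolding \<Psi>_def K_def by (simp add: FactRing_def)
    then have "?red a \<in> M" using ra M.a_rcos_self by metis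
    then obtain v2 where v2: "v2 \<in> carrier (UP (residue_ring 2))"
      "?red a = v2 \<otimes>\<^bsub>UP (residue_ring 2)\<^esub> f2"
      unfolding M_def cgenideal_def by blast
    obtain v where v: "v \<in> carrier (UP Z4)" "?red v = v2" using lift[OF v2(1)] by blast
    have vf: "v \<otimes>\<^bsub>UP Z4\<^esub> f \<in> carrier (UP Z4)" using v fc by simp
    define c where "c = a \<ominus>\<^bsub>UP Z4\<^esub> v \<otimes>\<^bsub>UP Z4\<^esub> f"
    have cc: "c \<in> carrier (UP Z4)" using a vf unfolding c_def by simp
    have "?red c = ?red a \<ominus>\<^bsub>UP (residue_ring 2)\<^esub> ?red (v \<otimes>\<^bsub>UP Z4\<^esub> f)"
      unfolding c_def a_minus_def using a vf by (simp only: red.hom_add red.hom_a_inv P4.P.a_inv_closed)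
    also have "?red (v \<otimes>\<^bsub>UP Z4\<^esub> f) = ?red a"
      using red.hom_mult[OF v(1) fc] v v2 by (simp add: f2_def)
    finally have "?red c = \<zero>\<^bsub>UP (residue_ring 2)\<^esub>" using ra by (simp add: P2.r_neg a_minus_def)
    then have "c n mod 2 = 0" for n by (simp add: UP_def residue_ring_def fun_eq_iff)
    then obtain d where d: "d \<in> carrier (UP Z4)" "c = d \<oplus>\<^bsub>UP Z4\<^esub> d"
      using even_UP_Z4[OF cc] by blast
    have "a = c \<oplus>\<^bsub>UP Z4\<^esub> v \<otimes>\<^bsub>UP Z4\<^esub> f"
      unfolding c_def using a vf by (simp add: a_minus_def P4.P.a_assoc P4.P.l_neg)
    then have "I +>\<^bsub>UP Z4\<^esub> a = I +>\<^bsub>UP Z4\<^esub> c"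
      using \<pi>f[OF v(1)] cc vf by simp
    then show ?thesis using d \<pi>.hom_closed by auto
  qed
  show four: "(x \<oplus>\<^bsub>R\<^esub> x) \<oplus>\<^bsub>R\<^esub> (x \<oplus>\<^bsub>R\<^esub> x) = \<zero>\<^bsub>R\<^esub>" if x: "x \<in> carrier R" for x
  proof -
    obtain a where a: "a \<in> carrier (UP Z4)" "x = I +>\<^bsub>UP Z4\<^esub> a" using surj_\<pi>[OF x] by blast
    have "(a \<oplus>\<^bsub>UP Z4\<^esub> a) \<oplus>\<^bsub>UP Z4\<^esub> (a \<oplus>\<^bsub>UP Z4\<^esub> a) = \<zero>\<^bsub>UP Z4\<^esub>"
    proof -
      have "((u + u) mod 4 + (u + u) mod 4) mod 4 = 0" for u :: int by presburger
      moreover have "(\<lambda>n. (a n + a n) mod 4) \<in> up Z4"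
        using P4.UP_a_closed[OF a(1) a(1)] a(1) by (simp add: UP_def residue_ring_def)
      ultimately show ?thesis using a(1) by (simp add: UP_def residue_ring_def)
    qed
    then show ?thesis using a by (metis P4.P.add.m_closed \<pi>.hom_add \<pi>.hom_zero)
  qed
  assume x: "x \<in> carrier R"
  obtain a where a: "a \<in> carrier (UP Z4)" "x = I +>\<^bsub>UP Z4\<^esub> a" using surj_\<pi>[OF x] by blast
  show "x \<in> Units R \<or> (\<exists>c\<in>carrier R. x = c \<oplus>\<^bsub>R\<^esub> c)"
  proof (cases "\<Psi> a = \<zero>\<^bsub>K\<^esub>")
    case True
    then show ?thesis using double a by blast
  next
    case False
    then have "\<Psi> a \<in> Units K" using a \<Psi>.hom_closed by (auto simp: K.field_Units)
    then obtain y where y: "y \<in> carrier K" "\<Psi> a \<otimes>\<^bsub>K\<^esub> y = \<one>\<^bsub>K\<^esub>"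
      using K.Units_r_inv_ex by blast
    \<comment> \<open>The inverse exists only in K; its lift b inverts a up to an element of the
      kernel of \<open>\<Psi>\<close>, that is, up to some c + c in R.\<close>
    obtain b where b: "b \<in> carrier (UP Z4)" "y = \<Psi> b" using surj_\<Psi>[OF y(1)] by blast
    define s where "s = a \<otimes>\<^bsub>UP Z4\<^esub> b"
    have s: "s \<in> carrier (UP Z4)" using a b by (simp add: s_def)
    have "\<Psi> (s \<ominus>\<^bsub>UP Z4\<^esub> \<one>\<^bsub>UP Z4\<^esub>) = \<zero>\<^bsub>K\<^esub>"
      unfolding a_minus_def using a b y s by (simp add: s_def K.r_neg)
    moreover have sd: "s \<ominus>\<^bsub>UP Z4\<^esub> \<one>\<^bsub>UP Z4\<^esub> \<in> carrier (UP Z4)"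
      using s by (rule P4.P.minus_closed) (rule P4.P.one_closed)
    ultimately obtain c where c: "c \<in> carrier R"
      "I +>\<^bsub>UP Z4\<^esub> (s \<ominus>\<^bsub>UP Z4\<^esub> \<one>\<^bsub>UP Z4\<^esub>) = c \<oplus>\<^bsub>R\<^esub> c"
      using double[OF sd] by blast
    define z where "z = I +>\<^bsub>UP Z4\<^esub> b"
    have z: "z \<in> carrier R" unfolding z_def by (rule \<pi>.hom_closed[OF b(1)])
    have "s = (s \<ominus>\<^bsub>UP Z4\<^esub> \<one>\<^bsub>UP Z4\<^esub>) \<oplus>\<^bsub>UP Z4\<^esub> \<one>\<^bsub>UP Z4\<^esub>"
      using s by (simp only: a_minus_def P4.P.a_assoc P4.P.l_neg P4.P.one_closed
          P4.P.a_inv_closed P4.P.r_zero)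
    then have "I +>\<^bsub>UP Z4\<^esub> s = (c \<oplus>\<^bsub>R\<^esub> c) \<oplus>\<^bsub>R\<^esub> \<one>\<^bsub>R\<^esub>"
      using \<pi>.hom_add[OF sd P4.P.one_closed] by (simp only: c(2) \<pi>.hom_one)
    then have "x \<otimes>\<^bsub>R\<^esub> z = (c \<oplus>\<^bsub>R\<^esub> c) \<oplus>\<^bsub>R\<^esub> \<one>\<^bsub>R\<^esub>"
      using \<pi>.hom_mult[OF a(1) b(1)] by (simp only: s_def z_def a(2))
    then have "x \<otimes>\<^bsub>R\<^esub> z \<in> Units R"
      using R.double_plus_one_unit[OF four c(1)] by simp
    then have "x \<in> Units R"
      using x z by (rule R.unit_factor)
    then show ?thesis ..
  qed
qed

section \<open>Cyclotomic classes of order 4\<close>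

lemma coprime_not_dvd:
  assumes "coprime u r" "r > 1"
  shows "\<not> r dvd (u :: nat)"
proof
  assume "r dvd u"
  then obtain j where "u = r * j" by (rule dvdE)
  then show False using assms by simp
qed

lemma residue_primroot_power_cong:
  assumes "residue_primroot r G" and "Factorial_Ring.prime r"
  shows "[G ^ a = G ^ b] (mod r) \<longleftrightarrow> [a = b] (mod (r - 1))"
  using assms order_divides_expdiff[of r G a b]
  by (simp add: residue_primroot_def totient_prime)

text \<open>Powers of a primitive root exhaust the nonzero residues, and the unit c merely permutes
  them; c will be a power of \<open>H\<close>.\<close>

lemma residue_primroot_bij:
  assumes r: "Factorial_Ring.prime r" "residue_primroot r G" and c: "coprime c r"
  shows "bij_betw (\<lambda>s. G ^ s * c mod r) {..<r - 1} {1..r - 1}"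
proof -
  let ?t = "\<lambda>s. G ^ s * c mod r"
  have r1: "r > 1" using r(1) by (rule prime_gt_1_nat)
  have cop: "coprime G r" using r by (simp add: residue_primroot_def coprime_commute)
  have injt: "inj_on ?t {..<r - 1}"
  proof (rule inj_onI)
    fix s t assume st: "s \<in> {..<r - 1}" "t \<in> {..<r - 1}" "?t s = ?t t"
    then have "[G ^ s * c = G ^ t * c] (mod r)" by (simp add: cong_def)
    then have "[G ^ s = G ^ t] (mod r)" using c by (simp add: cong_mult_rcancel_nat)
    then have "[s = t] (mod (r - 1))" by (simp only: residue_primroot_power_cong[OF r(2,1)])
    then show "s = t" using st by (simp add: cong_def)
  qed
  have "?t ` {..<r - 1} = {1..r - 1}"
  proof (rule card_subset_eq)
    show "?t ` {..<r - 1} \<subseteq> {1..r - 1}"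
    proof
      fix y assume "y \<in> ?t ` {..<r - 1}"
      then obtain s where y: "y = ?t s" by blast
      have "coprime (G ^ s * c) r" using cop c by simp
      then have "\<not> r dvd G ^ s * c" using r1 by (rule coprime_not_dvd)
      then have "y \<noteq> 0" unfolding y by (simp add: mod_eq_0_iff_dvd)
      moreover have "y < r" unfolding y using r1 by simp
      ultimately show "y \<in> {1..r - 1}" by simp
    qed
    show "card (?t ` {..<r - 1}) = card {1..r - 1}" using card_image[OF injt] by simp
  qed simp
  with injt show ?thesis by (simp only: bij_betw_def)
qed

locale cyclotomic4 =
  fixes p q :: nat and g h :: int
  assumes prime_p: "Factorial_Ring.prime p" and prime_q: "Factorial_Ring.prime q"
    and p_neq_q: "p \<noteq> q" and gcd_4: "gcd (p - 1) (q - 1) = 4"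
    and primroot: "common_primitive_root p q g"
    and h_p: "[h = g] (mod int p)" and h_q: "[h = 1] (mod int q)"
begin

definition e :: nat where "e = (p - 1) * (q - 1) div 4"
text \<open>\<open>G\<close> and \<open>H\<close> are natural representatives of g and h modulo pq,
  so that all powers and congruences can be handled in the natural numbers.\<close>

definition G :: nat where "G = nat (g mod int (p * q))"
definition H :: nat where "H = nat (h mod int (p * q))"
definition D :: "nat \<Rightarrow> nat set" where "D = cyc_class p q g h"

lemma p_pos: "p > 1" and q_pos: "q > 1" and T_pos: "p * q > 0"
  using prime_p prime_q prime_gt_1_nat prime_gt_0_nat by auto

lemma coprime_pq: "coprime p q"
  using prime_p prime_q p_neq_q by (simp add: primes_coprime)

lemma dvd_4: "4 dvd p - 1" "4 dvd q - 1"
  using gcd_4 by (metis gcd_dvd1, metis gcd_dvd2)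

lemma four_e: "4 * e = (p - 1) * (q - 1)"
  using dvd_4(1) unfolding e_def by (metis dvd_mult2 dvd_mult_div_cancel)

text \<open>Shows e as a whole number of periods q - 1, respectively p - 1; the cofactors become the
  multiplicities m in \<open>S_residue\<close>.\<close>

lemma e_eq: "e = (p - 1) div 4 * (q - 1)" "e = (q - 1) div 4 * (p - 1)"
  unfolding e_def using dvd_4 by (simp add: dvd_div_mult, metis dvd_div_mult mult.commute)

text \<open>Allows congruences of exponents modulo p - 1 and q - 1 to be merged into one modulo e,
  the length of the range of s.\<close>

lemma lcm_e: "lcm (p - 1) (q - 1) = e"
proof -
  have "4 * lcm (p - 1) (q - 1) = 4 * e"
    using prod_gcd_lcm_nat[of "p - 1" "q - 1"] four_e by (simp only: gcd_4)
  then show ?thesis by simp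
qed

lemma int_G: "int G = g mod int (p * q)" and int_H: "int H = h mod int (p * q)"
  using T_pos unfolding G_def H_def by auto

lemma primroot_p: "residue_primroot p G" and primroot_q: "residue_primroot q G"
proof -
  have "int (G mod p) = g mod int p" "int (G mod q) = g mod int q"
    by (simp_all add: zmod_int int_G mod_mod_cancel)
  then have "G mod p = nat (g mod int p)" "G mod q = nat (g mod int q)" by (metis nat_int)+
  with primroot have "residue_primroot p (G mod p)" "residue_primroot q (G mod q)"
    by (simp_all add: common_primitive_root_def)
  then show "residue_primroot p G" "residue_primroot q G" by simp_all
qed

lemma H_p: "[H = G] (mod p)"
proof -
  have "[int H = int G] (mod int p)"
    using h_p unfolding int_G int_H by (simp add: cong_def mod_mod_cancel)
  then show ?thesis by (simp add: cong_int_iff)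
qed

lemma H_q: "[H = 1] (mod q)"
proof -
  have "[int H = int 1] (mod int q)"
    using h_q unfolding int_H by (simp add: cong_def mod_mod_cancel)
  then show ?thesis using cong_int_iff by blast
qed

lemma D_eq: "D i = (\<lambda>s. G ^ s * H ^ i mod (p * q)) ` {..<e}"
proof -
  have "nat ((g ^ s * h ^ i) mod int (p * q)) = G ^ s * H ^ i mod (p * q)" for s
  proof -
    have "[int G ^ s * int H ^ i = g ^ s * h ^ i] (mod int (p * q))"
      by (intro cong_mult cong_pow) (simp_all add: int_G int_H cong_def)
    then have "int (G ^ s * H ^ i mod (p * q)) = (g ^ s * h ^ i) mod int (p * q)"
      by (simp add: cong_def zmod_int)
    then show ?thesis by (metis nat_int)
  qed
  then show ?thesis unfolding D_def cyc_class_def e_def by auto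
qed

text \<open>Together with \<open>GH_q\<close>: the element with parameters s and i has logarithm s +
  i modulo p and s modulo q, so the class index is the difference of the two logarithms.\<close>

lemma GH_p: "[G ^ s * H ^ i = G ^ (s + i)] (mod p)"
  using cong_mult[OF cong_refl cong_pow[OF H_p]] by (simp add: power_add)

lemma GH_q: "[G ^ s * H ^ i = G ^ s] (mod q)"
  using cong_mult[OF cong_refl cong_pow[OF H_q]] by fastforce

lemma coprime_G: "coprime G p" "coprime G q"
  using primroot_p primroot_q by (auto simp: residue_primroot_def coprime_commute)

lemma coprime_H: "coprime H p" "coprime H q"
  using cong_imp_coprime[OF cong_sym[OF H_p]] cong_imp_coprime[OF cong_sym[OF H_q]] coprime_G
  by auto

lemma cong_pq: "[x = y] (mod p * q) \<longleftrightarrow> [x = y] (mod p) \<and> [x = y] (mod q)" for x y :: nat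
proof
  assume "[x = y] (mod p * q)"
  then show "[x = y] (mod p) \<and> [x = y] (mod q)"
    using cong_dvd_modulus_nat dvd_triv_left dvd_triv_right by blast
next
  assume "[x = y] (mod p) \<and> [x = y] (mod q)"
  then show "[x = y] (mod p * q)" using coprime_cong_mult_nat coprime_pq by blast
qed

text \<open>The logarithms are determined modulo p - 1 and q - 1, both divisible by 4, so their
  difference recovers k. Then s is known modulo both numbers, hence modulo their lcm e.\<close>

lemma GH_inj:
  assumes "[G ^ s * H ^ k = G ^ s' * H ^ k'] (mod p * q)" "s < e" "s' < e" "k < 4" "k' < 4"
  shows "s = s' \<and> k = k'"
proof -
  have "[G ^ (s + k) = G ^ (s' + k')] (mod p)" "[G ^ s = G ^ s'] (mod q)"
    using assms(1) GH_p GH_q unfolding cong_pq by (meson cong_sym cong_trans)+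
  then have c: "[s + k = s' + k'] (mod (p - 1))" "[s = s'] (mod (q - 1))"
    using residue_primroot_power_cong primroot_p primroot_q prime_p prime_q by simp_all
  then have "[s + k = s' + k'] (mod 4)" "[s = s'] (mod 4)"
    using dvd_4 cong_dvd_modulus_nat by blast+
  then have "[s + k = s + k'] (mod 4)"
    by (meson cong_add cong_refl cong_sym cong_trans)
  then have "[k = k'] (mod 4)" by (simp add: cong_add_lcancel_nat)
  then have k: "k = k'" using assms by (simp add: cong_def)
  then have "[s = s'] (mod (p - 1))" using c(1) by (simp add: cong_add_rcancel_nat)
  then have "[s = s'] (mod e)" using c(2) lcm_e by (metis cong_cong_lcm_nat)
  then show ?thesis using assms k by (simp add: cong_def)
qed

lemma card_D:
  assumes "k < 4"
  shows "card (D k) = e"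
proof -
  have "inj_on (\<lambda>s. G ^ s * H ^ k mod (p * q)) {..<e}"
  proof (rule inj_onI)
    fix s s' assume "s \<in> {..<e}" "s' \<in> {..<e}" "G ^ s * H ^ k mod (p * q) = G ^ s' * H ^ k mod (p * q)"
    then show "s = s'" using GH_inj[of s k s' k] assms by (simp add: cong_def)
  qed
  then show ?thesis unfolding D_eq by (simp add: card_image)
qed

lemma finite_D: "finite (D k)"
  unfolding D_eq by simp

lemma D_disjoint:
  assumes "k < 4" "k' < 4" "k \<noteq> k'"
  shows "D k \<inter> D k' = {}"
proof (rule ccontr)
  assume "D k \<inter> D k' \<noteq> {}"
  then obtain x where "x \<in> D k" "x \<in> D k'" by blast
  then obtain s s' where "s < e" "s' < e"
    "x = G ^ s * H ^ k mod (p * q)" "x = G ^ s' * H ^ k' mod (p * q)"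
    unfolding D_eq by blast
  then show False using GH_inj[of s k s' k'] assms by (simp add: cong_def)
qed

lemma D_cong:
  assumes "x \<in> D k"
  obtains s where "[x = G ^ s] (mod q)" "[x = G ^ (s + k)] (mod p)"
proof -
  obtain s where "x = G ^ s * H ^ k mod (p * q)" using assms unfolding D_eq by auto
  then have "[x = G ^ s * H ^ k] (mod p * q)" by (simp add: cong_def)
  then show ?thesis using that GH_p GH_q unfolding cong_pq by (meson cong_trans)
qed

lemma D_less: "x \<in> D k \<Longrightarrow> x < p * q"
  unfolding D_eq using T_pos by auto

lemma D_coprime:
  assumes "x \<in> D k"
  shows "coprime x p" "coprime x q"
proof -
  obtain s where "[x = G ^ s] (mod q)" "[x = G ^ (s + k)] (mod p)" using assms by (rule D_cong)
  then show "coprime x p" "coprime x q"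
    using coprime_G by (metis cong_imp_coprime cong_sym coprime_power_left_iff)+
qed

text \<open>By counting: four disjoint classes of e units each amount to (p - 1)(q - 1), the number
  of all units.\<close>

lemma D_Union: "(\<Union>k\<in>{0..3}. D k) = {x. x < p * q \<and> coprime x p \<and> coprime x q}" (is "?L = ?R")
proof (rule card_subset_eq)
  show "finite ?R" by simp
  show "?L \<subseteq> ?R" using D_less D_coprime by blast
  have "card ?L = (\<Sum>k\<in>{0..3}. card (D k))"
    using D_disjoint by (intro card_UN_disjoint) (auto simp: finite_D)
  also have "\<dots> = (p - 1) * (q - 1)" using card_D four_e by (simp add: numeral_eq_Suc)
  also have "\<dots> = totient (p * q)"
    using coprime_pq prime_p prime_q by (simp add: totient_mult_coprime totient_prime)
  also have "\<dots> = card ?R"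
  proof -
    \<comment> \<open>\<open>totatives\<close> ranges over 1..pq whereas \<open>?R\<close> ranges
      over 0..pq-1; neither end point 0 nor pq is coprime to p.\<close>
    have "x \<noteq> 0" if "coprime x p" for x
      using that p_pos by (intro notI) simp
    moreover have "x \<noteq> p * q" if "coprime x p" for x
      using that p_pos by (intro notI) simp
    ultimately have "?R = totatives (p * q)"
      unfolding totatives_def by fastforce
    then show ?thesis by (simp add: totient_def)
  qed
  finally show "card ?L = card ?R" .
qed

text \<open>Converse of \<open>D_cong\<close>. Some class D j contains x, and comparing the
  logarithms it has there with a and b modulo 4 forces j = k.\<close>

lemma D_I:
  assumes "x < p * q" "[x = G ^ a] (mod q)" "[x = G ^ b] (mod p)" "[b = a + k] (mod 4)" "k < 4"
  shows "x \<in> D k"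
proof -
  have "coprime x p" "coprime x q"
    using cong_imp_coprime[OF cong_sym[OF assms(2)]] cong_imp_coprime[OF cong_sym[OF assms(3)]]
      coprime_G by auto
  then have "x \<in> (\<Union>k\<in>{0..3}. D k)" unfolding D_Union using assms(1) by simp
  then obtain j where "j \<in> {0..3}" and j2: "x \<in> D j" by blast
  then have j: "j < 4" "x \<in> D j" by simp_all
  obtain s where s: "[x = G ^ s] (mod q)" "[x = G ^ (s + j)] (mod p)" using j(2) by (rule D_cong)
  have "[G ^ a = G ^ s] (mod q)" "[G ^ b = G ^ (s + j)] (mod p)"
    using s assms(2,3) by (meson cong_sym cong_trans)+
  then have "[a = s] (mod (q - 1))" "[b = s + j] (mod (p - 1))"
    using residue_primroot_power_cong primroot_p primroot_q prime_p prime_q by simp_all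
  then have "[a = s] (mod 4)" "[b = s + j] (mod 4)"
    using dvd_4 cong_dvd_modulus_nat by blast+
  then have "[a + k = a + j] (mod 4)"
    using assms(4) by (meson cong_add cong_refl cong_sym cong_trans)
  then have "[k = j] (mod 4)" by (simp only: cong_add_lcancel_nat)
  then have "j = k" using assms(5) j(1) by (simp add: cong_def)
  then show ?thesis using j by simp
qed

lemma D_mult:
  assumes "x \<in> D j" "y \<in> D k"
  shows "x * y mod (p * q) \<in> D ((j + k) mod 4)"
proof -
  obtain s where s: "[x = G ^ s] (mod q)" "[x = G ^ (s + j)] (mod p)" using assms(1) by (rule D_cong)
  obtain t where t: "[y = G ^ t] (mod q)" "[y = G ^ (t + k)] (mod p)" using assms(2) by (rule D_cong)
  have "[x * y mod (p * q) = x * y] (mod p * q)" by (simp add: cong_def)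
  then have "[x * y mod (p * q) = G ^ (s + t)] (mod q)"
    "[x * y mod (p * q) = G ^ (s + j + (t + k))] (mod p)"
    using cong_mult[OF s(1) t(1)] cong_mult[OF s(2) t(2)] unfolding cong_pq power_add
    by (metis cong_trans)+
  moreover have "[s + t + (j + k) = s + t + (j + k) mod 4] (mod 4)"
    by (simp add: cong_def mod_simps)
  then have "[s + j + (t + k) = s + t + (j + k) mod 4] (mod 4)" by (simp add: ac_simps)
  ultimately show ?thesis
    using T_pos by (intro D_I[where a = "s + t" and b = "s + j + (t + k)"]) simp_all
qed

lemma D_mult_image:
  assumes "x \<in> D j" "k < 4"
  shows "bij_betw (\<lambda>u. x * u mod (p * q)) (D k) (D ((j + k) mod 4))"
proof -
  have "inj_on (\<lambda>u. x * u mod (p * q)) (D k)"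
  proof (rule inj_onI)
    fix u v assume uv: "u \<in> D k" "v \<in> D k" and "x * u mod (p * q) = x * v mod (p * q)"
    then have "[x * u = x * v] (mod p * q)" by (simp add: cong_def)
    moreover have "coprime x (p * q)" using D_coprime[OF assms(1)] by simp
    ultimately have "[u = v] (mod p * q)" by (simp add: cong_mult_lcancel_nat)
    then show "u = v" using uv D_less by (simp add: cong_def)
  qed
  moreover from this have "(\<lambda>u. x * u mod (p * q)) ` D k = D ((j + k) mod 4)"
    using D_mult[OF assms(1)] assms(2)
    by (intro card_subset_eq finite_D) (auto simp: card_image card_D)
  ultimately show ?thesis by (simp add: bij_betw_def)
qed

lemma minus_one_D:
  assumes "[p = 5] (mod 8)" "[q = 5] (mod 8)"
  shows "p * q - 1 \<in> D 0"
proof -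
  \<comment> \<open>The half power of a primitive root squares to 1 without being 1, so it is -1,
    written r - 1.\<close>
  have half: "[G ^ ((r - 1) div 2) = r - 1] (mod r)"
    if r: "Factorial_Ring.prime r" "odd r" and pr: "residue_primroot r G" for r
  proof -
    let ?x = "G ^ ((r - 1) div 2)"
    have r1: "r > 2" using r by (metis even_numeral le_neq_implies_less prime_ge_2_nat)
    have "?x * ?x = G ^ (r - 1)" using r by (simp flip: power_add mult_2)
    moreover have "[G ^ (r - 1) = G ^ 0] (mod r)"
      unfolding residue_primroot_power_cong[OF pr r(1)] by (simp add: cong_def)
    ultimately have sq: "[?x * ?x = 1] (mod r)" by simp
    have "?x \<noteq> 0" using pr r1 by (cases "G = 0") (simp_all add: residue_primroot_def)
    \<comment> \<open>With ?x = y + 1 the difference ?x^2 - 1 becomes y (y + 2), which avoids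
      truncated subtraction.\<close>
    then obtain y where y: "?x = Suc y" using not0_implies_Suc by blast
    have "[y * (y + 2) + 1 = 0 + 1] (mod r)" using sq unfolding y by (simp add: algebra_simps)
    then have "r dvd y * (y + 2)" unfolding cong_add_rcancel_nat by (simp add: cong_0_iff)
    then have "r dvd y \<or> r dvd y + 2" using r(1) by (simp only: prime_dvd_mult_iff)
    then have "[?x = 1] (mod r) \<or> [?x = r - 1] (mod r)"
    proof
      assume "r dvd y"
      then have "[y + 1 = 0 + 1] (mod r)" unfolding cong_add_rcancel_nat by (simp add: cong_0_iff)
      then show ?thesis unfolding y by simp
    next
      assume "r dvd y + 2"
      then have "[Suc y + 1 = r - 1 + 1] (mod r)" using r1 by (simp add: cong_def)
      then show ?thesis unfolding y cong_add_rcancel_nat by simp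
    qed
    moreover have "\<not> [?x = G ^ 0] (mod r)"
      using r1 r unfolding residue_primroot_power_cong[OF pr r(1)] by (auto simp: cong_def)
    ultimately show ?thesis by simp
  qed
  have odd_5: "odd r" if "[r = 5] (mod 8)" for r :: nat
    using that unfolding cong_def by presburger
  note odd = odd_5[OF assms(1)] odd_5[OF assms(2)]
  have *: "[a * b - 1 = a - 1] (mod a)" if "a > 1" "b > 1" for a b :: nat
  proof -
    have "a * b - 1 = a - 1 + a * (b - 1)"
      using that by (simp add: algebra_simps diff_mult_distrib2)
    then show ?thesis by (simp only: cong_def mod_mult_self2)
  qed
  have "[p * q - 1 = p - 1] (mod p)" "[p * q - 1 = q - 1] (mod q)"
    using *[OF p_pos q_pos] *[OF q_pos p_pos] by (simp_all only: mult.commute[of q p])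
  then have "[p * q - 1 = G ^ ((q - 1) div 2)] (mod q)" "[p * q - 1 = G ^ ((p - 1) div 2)] (mod p)"
    using half[OF prime_p odd(1) primroot_p] half[OF prime_q odd(2) primroot_q]
    by (meson cong_sym cong_trans)+
  moreover have "[(p - 1) div 2 = (q - 1) div 2 + 0] (mod 4)"
  proof -
    have "(r - 1) div 2 mod 4 = 2" if "[r = 5] (mod 8)" for r :: nat
    proof -
      have "r mod 8 = 5" using that by (simp add: cong_def)
      then obtain m where "r = 8 * m + 5" by (metis mult_div_mod_eq)
      then have "(r - 1) div 2 = 4 * m + 2" by simp
      then show ?thesis by presburger
    qed
    then show ?thesis using assms by (simp add: cong_def)
  qed
  ultimately show ?thesis using T_pos by (intro D_I) auto
qed

text \<open>The residue 0 is grouped with the multiples of q, because the sequence has the value 2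
  on both and the sum over j in the result starts at 0.\<close>

lemma lessThan_partition:
  "{..<p * q} = (\<lambda>j. j * q) ` {0..p - 1} \<union> (\<lambda>j. j * p) ` {1..q - 1} \<union> (\<Union>k\<in>{0..3}. D k)"
proof (intro equalityI subsetI)
  fix x assume x: "x \<in> {..<p * q}"
  consider "q dvd x" | "p dvd x" "\<not> q dvd x" | "coprime x p" "coprime x q"
    using prime_p prime_q by (metis coprime_commute prime_imp_coprime)
  then show "x \<in> (\<lambda>j. j * q) ` {0..p - 1} \<union> (\<lambda>j. j * p) ` {1..q - 1} \<union> (\<Union>k\<in>{0..3}. D k)"
  proof cases
    case 1
    then obtain j where "x = j * q" by (metis dvd_def mult.commute)
    then show ?thesis using x q_pos by (auto intro!: image_eqI)
  next
    case 2
    then obtain j where j: "x = j * p" by (metis dvd_def mult.commute)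
    have "j \<noteq> 0" using 2(2) j by (intro notI) simp
    moreover have "j < q" using j x p_pos by (auto simp: mult.commute)
    ultimately have "j \<in> {1..q - 1}" by auto
    then show ?thesis unfolding j by blast
  next
    case 3
    then show ?thesis unfolding D_Union using x by simp
  qed
next
  fix x assume "x \<in> (\<lambda>j. j * q) ` {0..p - 1} \<union> (\<lambda>j. j * p) ` {1..q - 1} \<union> (\<Union>k\<in>{0..3}. D k)"
  then consider j where "x = j * q" "j \<le> p - 1" | j where "x = j * p" "j \<le> q - 1"
    | k where "x \<in> D k" unfolding Un_iff image_iff UN_iff by (meson atLeastAtMost_iff)
  then show "x \<in> {..<p * q}"
  proof cases
    case 1
    then have "x \<le> (p - 1) * q" by simp
    also have "\<dots> < p * q" using p_pos q_pos by simp
    finally show ?thesis by simp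
  next
    case 2
    then have "x \<le> (q - 1) * p" by simp
    also have "\<dots> < p * q" using p_pos q_pos by (simp add: mult.commute)
    finally show ?thesis by simp
  next
    case 3
    then show ?thesis using D_less by simp
  qed
qed

section \<open>Values of the sequence on the parts of the partition\<close>

lemma D_not_dvd:
  assumes "u \<in> D k"
  shows "\<not> p dvd u" "\<not> q dvd u"
  using D_coprime[OF assms] p_pos q_pos by (simp_all add: coprime_not_dvd)

lemma not_dvd_multiple:
  assumes "1 \<le> j" "j \<le> q - 1"
  shows "\<not> q dvd j * p"
proof
  assume "q dvd j * p"
  then have "q dvd j" using coprime_pq by (metis coprime_commute coprime_dvd_mult_left_iff)
  then show False using assms q_pos by (auto dest: dvd_imp_le)
qed

lemma quat_seq_multiple_q:
  assumes "j \<le> p - 1"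
  shows "quat_seq p q g h (j * q) = 2"
proof -
  have "j * q \<in> {..<p * q}"
    unfolding lessThan_partition by (intro UnI1 imageI) (use assms in simp)
  then have "j * q mod (p * q) \<in> mult_set_Q p q \<union> {0}"
    using assms unfolding mult_set_Q_def by (cases "j = 0") auto
  then show ?thesis by (simp add: quat_seq_def)
qed

lemma quat_seq_multiple_p:
  assumes "1 \<le> j" "j \<le> q - 1"
  shows "quat_seq p q g h (j * p) = 0"
proof -
  have "j * p \<in> {..<p * q}"
    unfolding lessThan_partition by (rule UnI1, rule UnI2, rule imageI) (use assms in simp)
  moreover have "j * p \<notin> mult_set_Q p q \<union> {0}"
  proof
    assume "j * p \<in> mult_set_Q p q \<union> {0}"
    then have "q dvd j * p" unfolding mult_set_Q_def by auto
    then show False using not_dvd_multiple[OF assms] by simp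
  qed
  moreover have "j * p \<in> mult_set_P p q"
    using assms unfolding mult_set_P_def by auto
  ultimately show ?thesis by (simp add: quat_seq_def)
qed

lemma quat_seq_D:
  assumes "u \<in> D k" "k < 4"
  shows "quat_seq p q g h u = int k"
proof -
  have u0: "u \<noteq> 0" using D_not_dvd(1)[OF assms(1)] by (metis dvd_0_right)
  have ul: "u mod (p * q) = u" using D_less[OF assms(1)] by (rule mod_less)
  have "u \<notin> mult_set_Q p q"
  proof
    assume "u \<in> mult_set_Q p q"
    then have "q dvd u" unfolding mult_set_Q_def by auto
    with D_not_dvd(2)[OF assms(1)] show False ..
  qed
  moreover have "u \<notin> mult_set_P p q"
  proof
    assume "u \<in> mult_set_P p q"
    then have "p dvd u" unfolding mult_set_P_def by auto
    with D_not_dvd(1)[OF assms(1)] show False ..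
  qed
  \<comment> \<open>Disjointness of the classes makes the definite description in
    \<open>quat_seq\<close> well defined.\<close>
  moreover have the: "(THE i. i < 4 \<and> u \<in> D i) = k"
  proof (rule the_equality)
    show "k < 4 \<and> u \<in> D k" using assms by simp
  next
    fix i assume i: "i < 4 \<and> u \<in> D i"
    show "i = k"
    proof (rule ccontr)
      assume "i \<noteq> k"
      then have "D i \<inter> D k = {}" using i assms(2) by (intro D_disjoint) auto
      moreover have "u \<in> D i \<inter> D k" using i assms(1) by simp
      ultimately show False by simp
    qed
  qed
  ultimately have "quat_seq p q g h u = int (THE i. i < 4 \<and> u \<in> D i)"
    using u0 unfolding quat_seq_def ul D_def by (simp only: Un_iff singleton_iff if_False simp_thms)
  then show ?thesis using the by (simp only:)
qed

end

section \<open>Sums of powers of a root of unity\<close>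

text \<open>Meant for class sums over s < e whose summand has period r - 1, a divisor of e.\<close>

lemma (in abelian_monoid) finsum_periodic:
  assumes f: "f \<in> UNIV \<rightarrow> carrier G" and per: "\<And>s::nat. f (s + n) = f s"
  shows "(\<Oplus>s\<in>{..<m * n}. f s) = [m] \<cdot> (\<Oplus>s\<in>{..<n}. f s)"
proof (induction m)
  case 0
  then show ?case by simp
next
  case (Suc m)
  have per': "f (s + m * n) = f s" for s
    by (induction m) (simp_all add: per add.assoc[symmetric] add.commute[of n])
  have "{..<Suc m * n} = {..<m * n} \<union> (\<lambda>s. s + m * n) ` {..<n}"
  proof (intro equalityI subsetI)
    fix x assume x: "x \<in> {..<Suc m * n}"
    show "x \<in> {..<m * n} \<union> (\<lambda>s. s + m * n) ` {..<n}"
    proof (cases "x < m * n")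
      case False
      then have "x = (x - m * n) + m * n" "x - m * n \<in> {..<n}" using x by auto
      then show ?thesis by blast
    qed simp
  qed auto
  also have "(\<Oplus>s\<in>\<dots>. f s) = (\<Oplus>s\<in>{..<m * n}. f s) \<oplus> (\<Oplus>s\<in>(\<lambda>s. s + m * n) ` {..<n}. f s)"
    using f by (intro finsum_Un_disjoint) auto
  also have "(\<Oplus>s\<in>(\<lambda>s. s + m * n) ` {..<n}. f s) = (\<Oplus>s\<in>{..<n}. f (s + m * n))"
    using f by (intro add.finprod_reindex) auto
  also have "\<dots> = (\<Oplus>s\<in>{..<n}. f s)"
    unfolding per' ..
  finally show ?case
    using Suc f by (simp add: Pi_def)
qed

lemma (in abelian_monoid) finsum_nat_pow:
  assumes "f \<in> A \<rightarrow> carrier G" "finite A"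
  shows "(\<Oplus>x\<in>A. [(k::nat)] \<cdot> f x) = [k] \<cdot> (\<Oplus>x\<in>A. f x)"
  using assms(2,1)
proof (induction A)
  case (insert x A)
  then show ?case by (simp add: Pi_def add.nat_pow_distrib)
qed simp

lemma (in abelian_monoid) finsum_4:
  assumes "F \<in> {0..3::nat} \<rightarrow> carrier G"
  shows "(\<Oplus>k\<in>{0..3}. F k) = F 0 \<oplus> F 1 \<oplus> F 2 \<oplus> F 3"
proof -
  have "{0..3::nat} = {0,1,2,3}" by auto
  then show ?thesis using assms by (simp add: a_ac Pi_def)
qed

text \<open>Stated for an arbitrary abelian monoid because it splits sums both in the Galois ring
  and in its polynomial ring.\<close>

lemma (in cyclotomic4) finsum_partition:
  assumes "abelian_monoid M" and F: "\<And>u. F u \<in> carrier M"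
  shows "(\<Oplus>\<^bsub>M\<^esub>u\<in>{..<p * q}. F u) =
    (\<Oplus>\<^bsub>M\<^esub>j\<in>{0..p - 1}. F (j * q)) \<oplus>\<^bsub>M\<^esub> (\<Oplus>\<^bsub>M\<^esub>j\<in>{1..q - 1}. F (j * p))
      \<oplus>\<^bsub>M\<^esub> (\<Oplus>\<^bsub>M\<^esub>k\<in>{0..3}. \<Oplus>\<^bsub>M\<^esub>u\<in>D k. F u)"
proof -
  interpret abelian_monoid M by fact
  let ?Q = "(\<lambda>j. j * q) ` {0..p - 1}" and ?P = "(\<lambda>j. j * p) ` {1..q - 1}" and ?D = "\<Union>k\<in>{0..3}. D k"
  have PQ: "?Q \<inter> ?P = {}"
  proof (rule ccontr)
    assume "?Q \<inter> ?P \<noteq> {}"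
    then obtain x where "x \<in> ?Q" "x \<in> ?P" by blast
    then obtain i j where "x = i * q" "x = j * p" "j \<in> {1..q - 1}" by blast
    then have "1 \<le> j" "j \<le> q - 1" "j * p = i * q" by auto
    with not_dvd_multiple[of j] show False by simp
  qed
  have "x \<notin> ?D" if "x \<in> ?Q \<union> ?P" for x
    using that D_not_dvd by fastforce
  then have PQD: "(?Q \<union> ?P) \<inter> ?D = {}" by blast
  have "(\<Oplus>\<^bsub>M\<^esub>u\<in>{..<p * q}. F u) = (\<Oplus>\<^bsub>M\<^esub>u\<in>?Q. F u) \<oplus>\<^bsub>M\<^esub> (\<Oplus>\<^bsub>M\<^esub>u\<in>?P. F u) \<oplus>\<^bsub>M\<^esub> (\<Oplus>\<^bsub>M\<^esub>u\<in>?D. F u)"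
    unfolding lessThan_partition using PQ PQD F finite_D
    by (simp add: finsum_Un_disjoint Pi_def del: UN_simps)
  also have "(\<Oplus>\<^bsub>M\<^esub>u\<in>?Q. F u) = (\<Oplus>\<^bsub>M\<^esub>j\<in>{0..p - 1}. F (j * q))"
    using F q_pos by (intro add.finprod_reindex) (auto simp: inj_on_def)
  also have "(\<Oplus>\<^bsub>M\<^esub>u\<in>?P. F u) = (\<Oplus>\<^bsub>M\<^esub>j\<in>{1..q - 1}. F (j * p))"
    using F p_pos by (intro add.finprod_reindex) (auto simp: inj_on_def)
  also have "(\<Oplus>\<^bsub>M\<^esub>u\<in>?D. F u) = (\<Oplus>\<^bsub>M\<^esub>k\<in>{0..3}. \<Oplus>\<^bsub>M\<^esub>u\<in>D k. F u)"
    using F finite_D D_disjoint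
    by (intro add.finprod_UN_disjoint) (auto simp: pairwise_def disjnt_def)
  finally show ?thesis .
qed

section \<open>Roots of unity of odd order when 4 = 0 and every element is a unit or a
  double\<close>

locale local_char4 = cring R for R (structure) +
  assumes four_zero: "x \<in> carrier R \<Longrightarrow> (x \<oplus> x) \<oplus> (x \<oplus> x) = \<zero>"
    and unit_or_double: "x \<in> carrier R \<Longrightarrow> x \<in> Units R \<or> (\<exists>c\<in>carrier R. x = c \<oplus> c)"
begin

lemma nat_mult_mod4:
  assumes "x \<in> carrier R" "n mod 4 = m mod 4"
  shows "[(n::nat)] \<cdot> x = [m] \<cdot> x"
proof -
  have "[n] \<cdot> x = [(n mod 4)] \<cdot> x" for n :: nat
  proof -
    have "[(4::nat)] \<cdot> x = (x \<oplus> x) \<oplus> (x \<oplus> x)"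
      using assms(1) by (simp add: numeral_eq_Suc a_ac)
    then have "[(4::nat)] \<cdot> x = \<zero>" using four_zero[OF assms(1)] by simp
    then have "[(4 * (n div 4))] \<cdot> x = \<zero>"
      unfolding add.nat_pow_pow[OF assms(1), of "n div 4" 4, symmetric] by simp
    then have "[(4 * (n div 4) + n mod 4)] \<cdot> x = [(n mod 4)] \<cdot> x"
      using assms(1) by (simp only: add.nat_pow_mult[OF assms(1), symmetric]) simp
    then show ?thesis by simp
  qed
  then show ?thesis using assms(2) by metis
qed

lemma root_minus_one_unit:
  assumes z: "z \<in> carrier R" and n: "odd n" "z [^] (n::nat) = \<one>" "z \<noteq> \<one>"
  shows "z \<ominus> \<one> \<in> Units R"
proof (rule ccontr)
  assume "z \<ominus> \<one> \<notin> Units R"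
  then obtain c where c: "c \<in> carrier R" "z \<ominus> \<one> = c \<oplus> c"
    using unit_or_double[of "z \<ominus> \<one>"] z by auto
  have "z = (z \<ominus> \<one>) \<oplus> \<one>" using z by algebra
  then have "z = c \<oplus> c \<oplus> \<one>" using c by simp
  then have "z \<otimes> z = \<one>" using double_plus_one_square[OF four_zero c(1)] by simp
  then have z2: "z [^] (2::nat) = \<one>" using z by (simp add: numeral_2_eq_2)
  \<comment> \<open>As z squares to 1, its odd power z^n is z itself, which contradicts z being
    different from 1.\<close>
  obtain m where "n = 2 * m + 1" using n(1) by (rule oddE)
  then have "z [^] n = (z [^] (2::nat)) [^] m \<otimes> z"
    using z by (simp add: nat_pow_pow)
  then show False using n z z2 by simp
qed

lemma geometric_sum_mult:
  assumes "z \<in> carrier R"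
  shows "(z \<ominus> \<one>) \<otimes> (\<Oplus>j\<in>{..<n::nat}. z [^] j) = z [^] n \<ominus> \<one>"
proof (induction n)
  case 0
  then show ?case using assms by (simp add: a_minus_def r_neg)
next
  case (Suc n)
  let ?S = "\<Oplus>j\<in>{..<n}. z [^] j"
  have S: "?S \<in> carrier R" using assms by (intro finsum_closed) auto
  have "{..<Suc n} = insert n {..<n}" by auto
  then have "(\<Oplus>j\<in>{..<Suc n}. z [^] j) = z [^] n \<oplus> ?S"
    using assms by (simp add: Pi_def)
  then have "(z \<ominus> \<one>) \<otimes> (\<Oplus>j\<in>{..<Suc n}. z [^] j) = (z \<ominus> \<one>) \<otimes> z [^] n \<oplus> (z \<ominus> \<one>) \<otimes> ?S"
    using assms S by (simp add: r_distr)
  also have "\<dots> = (z \<ominus> \<one>) \<otimes> z [^] n \<oplus> (z [^] n \<ominus> \<one>)" by (simp only: Suc)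
  also have "\<dots> = z [^] n \<otimes> z \<ominus> \<one>"
  proof -
    have "(z \<ominus> \<one>) \<otimes> t \<oplus> (t \<ominus> \<one>) = t \<otimes> z \<ominus> \<one>" if "t \<in> carrier R" for t
      using assms that by algebra
    then show ?thesis using assms by simp
  qed
  finally show ?case by simp
qed

text \<open>The ring may have zero divisors, so cancelling z - 1 from the telescoped product rests
  on its being a unit.\<close>

lemma root_of_unity_sum_zero:
  assumes z: "z \<in> carrier R" and n: "odd n" "z [^] (n::nat) = \<one>" "z \<noteq> \<one>"
  shows "(\<Oplus>j\<in>{..<n}. z [^] j) = \<zero>"
proof -
  let ?S = "\<Oplus>j\<in>{..<n}. z [^] j"
  have S: "?S \<in> carrier R" using z by (intro finsum_closed) auto
  have u: "z \<ominus> \<one> \<in> Units R" using assms by (rule root_minus_one_unit)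
  have "(z \<ominus> \<one>) \<otimes> ?S = \<zero>" using geometric_sum_mult[OF z, of n] n by (simp add: a_minus_def r_neg)
  then have "(z \<ominus> \<one>) \<otimes> ?S = (z \<ominus> \<one>) \<otimes> \<zero>" using Units_closed[OF u] by simp
  then show ?thesis using u S Units_l_cancel[OF u S zero_closed] by simp
qed

end

section \<open>Class sums at powers of the root of unity\<close>

locale cyclotomic4_root = cyclotomic4 p q g h + local_char4 R
  for p q :: nat and g h :: int and R (structure) +
  fixes \<beta>
  assumes \<beta>_closed: "\<beta> \<in> carrier R"
    and \<beta>_pow: "\<And>n::nat. \<beta> [^] n = \<one> \<longleftrightarrow> p * q dvd n"
    and p_mod: "[p = 5] (mod 8)" and q_mod: "[q = 5] (mod 8)"
begin

definition B :: "nat \<Rightarrow> 'a" where "B n = \<beta> [^] n"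
text \<open>This is the value of the class polynomial D_k at the w-th power of \<beta>.\<close>

definition S :: "nat \<Rightarrow> nat \<Rightarrow> 'a" where "S w k = (\<Oplus>u\<in>D k. B (w * u))"

lemma B_closed [simp]: "B n \<in> carrier R"
  unfolding B_def using \<beta>_closed by simp

lemma B_add: "B (m + n) = B m \<otimes> B n"
  unfolding B_def using \<beta>_closed by (simp add: nat_pow_mult)

lemma B_eq_1: "B n = \<one> \<longleftrightarrow> p * q dvd n"
  unfolding B_def by (rule \<beta>_pow)

lemma B_power: "B m [^] n = B (m * n)"
  unfolding B_def using \<beta>_closed by (simp add: nat_pow_pow)

lemma B_mod: "B (n mod (p * q)) = B n"
proof -
  have "B (p * q * (n div (p * q)) + n mod (p * q)) = B (n mod (p * q))"
    unfolding B_add using B_eq_1[of "p * q * (n div (p * q))"] by simp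
  then show ?thesis by simp
qed

lemma B_cong: "[m = n] (mod p * q) \<Longrightarrow> B m = B n"
  using B_mod[of m] B_mod[of n] by (simp add: cong_def)

lemma S_closed [simp]: "S w k \<in> carrier R"
  unfolding S_def by (intro finsum_closed) auto

lemma odd_p: "odd p" and odd_q: "odd q"
proof -
  have "odd r" if "[r = 5] (mod 8)" for r :: nat
    using that unfolding cong_def by presburger
  then show "odd p" "odd q" using p_mod q_mod by blast+
qed

lemma B_sum_zero:
  assumes "\<not> p * q dvd w" "p * q dvd w * n" "odd n"
  shows "(\<Oplus>j\<in>{..<n}. B (w * j)) = \<zero>"
  using root_of_unity_sum_zero[of "B w" n] assms by (simp add: B_power B_eq_1)

lemma B_sum_nonzero:
  assumes "\<not> p * q dvd w" "p * q dvd w * n" "odd n"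
  shows "(\<Oplus>j\<in>{1..n - 1}. B (w * j)) = \<ominus> \<one>"
proof -
  let ?S = "\<Oplus>j\<in>{1..n - 1}. B (w * j)"
  have S: "?S \<in> carrier R" by (intro finsum_closed) auto
  have "{..<n} = insert 0 {1..n - 1}" using assms(3) by (cases n) auto
  then have "(\<Oplus>j\<in>{..<n}. B (w * j)) = B 0 \<oplus> ?S" by simp
  then have "\<one> \<oplus> ?S = \<zero>" using B_sum_zero[OF assms] B_eq_1[of 0] by simp
  then show ?thesis using S by (metis add.inv_equality a_comm one_closed)
qed

lemma S_unit:
  assumes "w mod (p * q) \<in> D j" "k < 4"
  shows "S w k = S 1 ((j + k) mod 4)"
proof -
  let ?t = "\<lambda>u. (w mod (p * q)) * u mod (p * q)"
  have bij: "bij_betw ?t (D k) (D ((j + k) mod 4))" by (rule D_mult_image[OF assms])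
  have "S 1 ((j + k) mod 4) = (\<Oplus>u\<in>?t ` D k. B u)"
    unfolding S_def using bij by (simp add: bij_betw_def)
  also have "\<dots> = (\<Oplus>u\<in>D k. B (?t u))"
    using bij by (intro add.finprod_reindex) (auto simp: bij_betw_def)
  also have "\<dots> = S w k"
    unfolding S_def by (intro finsum_cong') (auto intro!: B_cong simp: cong_def mod_simps)
  finally show ?thesis ..
qed

text \<open>The first hypothesis says that the r-th power of \<open>B w\<close> is 1, so exponents
  of \<open>B w\<close> matter only modulo r.\<close>

lemma B_mult_cong:
  assumes "p * q dvd w * r" "[x = y] (mod r)"
  shows "B (w * x) = B (w * y)"
proof -
  have "[w * x = w * y] (mod w * r)"
    using assms(2) unfolding cong_def mult_mod_right[symmetric] by simp
  then show ?thesis using assms(1) by (intro B_cong) (rule cong_dvd_modulus_nat)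
qed

lemma S_as_power_sum:
  assumes "k < 4"
  shows "S w k = (\<Oplus>s\<in>{..<e}. B (w * (G ^ s * H ^ k)))"
proof -
  let ?t = "\<lambda>s. G ^ s * H ^ k mod (p * q)"
  \<comment> \<open>The image has e elements, as many as the index set.\<close>
  have inj: "inj_on ?t {..<e}"
    using card_D[OF assms] unfolding D_eq by (intro eq_card_imp_inj_on) simp_all
  have "S w k = (\<Oplus>s\<in>{..<e}. B (w * ?t s))"
    unfolding S_def D_eq by (rule add.finprod_reindex[OF _ inj]) simp
  also have "\<dots> = (\<Oplus>s\<in>{..<e}. B (w * (G ^ s * H ^ k)))"
  proof (rule finsum_cong')
    fix s
    show "B (w * ?t s) = B (w * (G ^ s * H ^ k))"
      by (rule B_cong) (simp add: cong_def mod_mult_right_eq)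
  qed simp_all
  finally show ?thesis .
qed

text \<open>The hypotheses on w make \<open>B w\<close> a root of unity of prime order r. As s runs
  over one period, the exponent meets every nonzero residue modulo r once and contributes -1; there
  are m periods.\<close>

lemma S_residue:
  assumes r: "Factorial_Ring.prime r" "residue_primroot r G" "odd r" "coprime H r"
    and e: "e = m * (r - 1)" and w: "\<not> p * q dvd w" "p * q dvd w * r" and k: "k < 4"
  shows "S w k = [m] \<cdot> (\<ominus> \<one>)"
proof -
  define f where "f s = B (w * (G ^ s * H ^ k))" for s
  have "S w k = (\<Oplus>s\<in>{..<m * (r - 1)}. f s)"
    unfolding S_as_power_sum[OF k] e f_def ..
  also have "\<dots> = [m] \<cdot> (\<Oplus>s\<in>{..<r - 1}. f s)"
  proof (rule finsum_periodic)
    show "f \<in> UNIV \<rightarrow> carrier R" by (simp add: f_def)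
    fix s
    have "[G ^ (s + (r - 1)) = G ^ s] (mod r)"
      unfolding residue_primroot_power_cong[OF r(2,1)] by (simp add: cong_def)
    then have "[G ^ (s + (r - 1)) * H ^ k = G ^ s * H ^ k] (mod r)"
      by (rule cong_mult) (rule cong_refl)
    then show "f (s + (r - 1)) = f s"
      unfolding f_def by (rule B_mult_cong[OF w(2)])
  qed
  also have "(\<Oplus>s\<in>{..<r - 1}. f s) = (\<Oplus>y\<in>{1..r - 1}. B (w * y))"
  proof -
    let ?t = "\<lambda>s. G ^ s * H ^ k mod r"
    have bij: "bij_betw ?t {..<r - 1} {1..r - 1}"
      using r by (intro residue_primroot_bij) simp_all
    have "(\<Oplus>y\<in>{1..r - 1}. B (w * y)) = (\<Oplus>y\<in>?t ` {..<r - 1}. B (w * y))"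
      using bij by (simp only: bij_betw_def)
    also have "\<dots> = (\<Oplus>s\<in>{..<r - 1}. B (w * ?t s))"
      using bij by (intro add.finprod_reindex) (simp_all add: bij_betw_def)
    also have "\<dots> = (\<Oplus>s\<in>{..<r - 1}. f s)"
    proof (rule finsum_cong')
      fix s
      show "B (w * ?t s) = f s"
        unfolding f_def by (rule B_mult_cong[OF w(2)]) (simp add: cong_def)
    qed (simp_all add: f_def)
    finally show ?thesis ..
  qed
  also have "\<dots> = \<ominus> \<one>" using w r(3) by (rule B_sum_nonzero)
  finally show ?thesis .
qed

text \<open>The sum over all residues is 0. The multiples of q, including 0, contribute 0 and the
  nonzero multiples of p contribute -1, so 1 is left for the units.\<close>

lemma S_total: "S 1 0 \<oplus> S 1 1 \<oplus> S 1 2 \<oplus> S 1 3 = \<one>"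
proof -
  have n1: "\<not> p * q dvd 1" "\<not> p * q dvd p" "\<not> p * q dvd q"
    using p_pos q_pos by (auto dest!: dvd_imp_le)
  have "(\<Oplus>u\<in>{..<p * q}. B u) = \<zero>"
    using B_sum_zero[OF n1(1), of "p * q"] odd_p odd_q by simp
  moreover have "(\<Oplus>j\<in>{0..p - 1}. B (j * q)) = \<zero>"
  proof -
    have "{0..p - 1} = {..<p}" using p_pos by auto
    then show ?thesis using B_sum_zero[OF n1(3), of p] odd_p by (simp add: mult.commute)
  qed
  moreover have "(\<Oplus>j\<in>{1..q - 1}. B (j * p)) = \<ominus> \<one>"
    using B_sum_nonzero[OF n1(2), of q] odd_q by (simp add: mult.commute)
  moreover have "(\<Oplus>k\<in>{0..3}. \<Oplus>u\<in>D k. B u) = S 1 0 \<oplus> S 1 1 \<oplus> S 1 2 \<oplus> S 1 3"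
    using finsum_4[of "S 1"] by (simp add: S_def)
  ultimately have "\<zero> = \<zero> \<oplus> \<ominus> \<one> \<oplus> (S 1 0 \<oplus> S 1 1 \<oplus> S 1 2 \<oplus> S 1 3)"
    using finsum_partition[OF abelian_monoid_axioms, of B] by simp
  moreover have "x = \<one>" if "\<zero> = \<zero> \<oplus> \<ominus> \<one> \<oplus> x" "x \<in> carrier R" for x
    using that by (metis add.inv_equality a_comm add.inv_closed add.inv_inv l_zero one_closed)
  ultimately show ?thesis by simp
qed

definition \<rho> where "\<rho> = S 1 1 \<oplus> [(2::nat)] \<cdot> S 1 2 \<oplus> [(3::nat)] \<cdot> S 1 3"

lemma rho_closed [simp]: "\<rho> \<in> carrier R"
  unfolding \<rho>_def by simp

text \<open>Put m = j + k modulo 4. The coefficient k of \<open>S 1 m\<close> is m - j modulo 4, so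
  the sum is \<rho> minus j times the total, which is 1 by \<open>S_total\<close>.\<close>

lemma shifted_sum:
  assumes "j < 4"
  shows "(\<Oplus>k\<in>{0..3}. [k] \<cdot> S 1 ((j + k) mod 4)) = \<rho> \<ominus> [j] \<cdot> \<one>"
proof -
  define a b c d where "a = S 1 0" and "b = S 1 1" and "c = S 1 2" and "d = S 1 3"
  have cl: "a \<in> carrier R" "b \<in> carrier R" "c \<in> carrier R" "d \<in> carrier R"
    unfolding a_def b_def c_def d_def by simp_all
  have tot: "\<one> = a \<oplus> b \<oplus> c \<oplus> d" unfolding a_def b_def c_def d_def using S_total by simp
  have rho: "\<rho> = b \<oplus> (c \<oplus> c) \<oplus> (d \<oplus> d \<oplus> d)"
    unfolding \<rho>_def b_def[symmetric] c_def[symmetric] d_def[symmetric]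
    using cl by (simp add: numeral_eq_Suc)
  have three: "x \<oplus> x \<oplus> x = \<ominus> x" if "x \<in> carrier R" for x
    using four_zero[OF that] that by (metis a_assoc add.inv_equality add.m_closed)
  have [simp]: "[(3::nat)] \<cdot> x = \<ominus> x" "[(2::nat)] \<cdot> x = x \<oplus> x" if "x \<in> carrier R" for x
    using three[OF that] that by (simp_all add: numeral_eq_Suc)
  have ev: "(\<Oplus>k\<in>{0..3}. [k] \<cdot> S 1 ((j + k) mod 4)) =
      S 1 ((j + 1) mod 4) \<oplus> (S 1 ((j + 2) mod 4) \<oplus> S 1 ((j + 2) mod 4)) \<oplus> \<ominus> S 1 ((j + 3) mod 4)"
    by (subst finsum_4) auto
  have rho': "\<rho> = b \<oplus> (c \<oplus> c) \<oplus> \<ominus> d" using rho three cl by simp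
  note abcd = a_def[symmetric] b_def[symmetric] c_def[symmetric] d_def[symmetric]
  consider "j = 0" | "j = 1" | "j = 2" | "j = 3" using assms by linarith
  then show ?thesis
  proof cases
    case 1
    then have j: "(j + 1) mod 4 = 1" "(j + 2) mod 4 = 2" "(j + 3) mod 4 = 3" by simp_all
    show ?thesis unfolding ev rho' j abcd using cl 1 by (simp add: a_minus_def)
  next
    case 2
    then have j: "(j + 1) mod 4 = 2" "(j + 2) mod 4 = 3" "(j + 3) mod 4 = 0" by simp_all
    \<comment> \<open>The extra summand 4d, which is zero here, turns this into an identity valid in
      every commutative ring. The next two cases are corrected in the same way.\<close>
    have "c \<oplus> (d \<oplus> d) \<oplus> \<ominus> a = b \<oplus> (c \<oplus> c) \<oplus> \<ominus> d \<ominus> (a \<oplus> b \<oplus> c \<oplus> d)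
        \<oplus> ((d \<oplus> d) \<oplus> (d \<oplus> d))"
      using cl by algebra
    then show ?thesis unfolding ev rho' j abcd using 2 cl four_zero[OF cl(4)]
      by (simp flip: tot)
  next
    case 3
    then have j: "(j + 1) mod 4 = 3" "(j + 2) mod 4 = 0" "(j + 3) mod 4 = 1" by simp_all
    have "d \<oplus> (a \<oplus> a) \<oplus> \<ominus> b = b \<oplus> (c \<oplus> c) \<oplus> \<ominus> d \<ominus> ((a \<oplus> b \<oplus> c \<oplus> d) \<oplus> (a \<oplus> b \<oplus> c \<oplus> d))
        \<oplus> ((d \<oplus> d) \<oplus> (d \<oplus> d)) \<oplus> ((a \<oplus> a) \<oplus> (a \<oplus> a))"
      using cl by algebra
    then show ?thesis unfolding ev rho' j abcd using 3 cl four_zero[OF cl(4)] four_zero[OF cl(1)]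
      by (simp flip: tot)
  next
    case 4
    then have j: "(j + 1) mod 4 = 0" "(j + 2) mod 4 = 1" "(j + 3) mod 4 = 2" by simp_all
    have "a \<oplus> (b \<oplus> b) \<oplus> \<ominus> c = b \<oplus> (c \<oplus> c) \<oplus> \<ominus> d \<ominus> \<ominus> (a \<oplus> b \<oplus> c \<oplus> d)
        \<ominus> ((c \<oplus> c) \<oplus> (c \<oplus> c))"
      using cl by algebra
    then show ?thesis unfolding ev rho' j abcd using 4 cl four_zero[OF cl(3)]
      by (simp add: a_minus_def flip: tot)
  qed
qed

section \<open>Coefficients of the Mattson-Solomon polynomial\<close>

definition coefficient :: "nat \<Rightarrow> 'a" where
  "coefficient i = ms_coeff R (p * q) (quat_seq p q g h) \<beta> i"

lemma inverse_power: "\<beta> [^] (- int n) = B ((p * q - 1) * n)"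
proof -
  have "B n \<otimes> B ((p * q - 1) * n) = B (n + (p * q - 1) * n)" by (simp add: B_add)
  also have "n + (p * q - 1) * n = p * q * n" using T_pos by (simp add: algebra_simps)
  also have "B \<dots> = \<one>" by (simp add: B_eq_1)
  finally have *: "B n \<otimes> B ((p * q - 1) * n) = \<one>" .
  then have "B ((p * q - 1) * n) = inv (B n)"
    by (intro inv_unique') (simp_all add: m_comm)
  moreover have "inv \<one> = \<one>" by simp
  \<comment> \<open>For n = 0 the exponent is not negative, so the integer power is then defined
    without an inverse.\<close>
  ultimately show ?thesis by (cases "n = 0") (auto simp: int_pow_def2 B_def)
qed

text \<open>The value 2 on multiples of q gives the first sum, the value 0 removes the nonzero
  multiples of p, and D k carries the value k.\<close>

lemma coefficient_eq:
  fixes i defines "w \<equiv> (p * q - 1) * i"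
  shows "coefficient i = [(2::nat)] \<cdot> (\<Oplus>j\<in>{..<p}. B (w * q * j)) \<oplus> (\<Oplus>k\<in>{0..3}. [k] \<cdot> S w k)"
proof -
  define F where "F u = [quat_seq p q g h u] \<cdot> B (w * u)" for u
  have F: "F u \<in> carrier R" for u unfolding F_def by simp
  have "coefficient i = (\<Oplus>u\<in>{..<p * q}. F u)"
    unfolding coefficient_def ms_coeff_def F_def inverse_power w_def by (simp add: mult.assoc)
  also have "\<dots> = (\<Oplus>j\<in>{0..p - 1}. F (j * q)) \<oplus> (\<Oplus>j\<in>{1..q - 1}. F (j * p))
      \<oplus> (\<Oplus>k\<in>{0..3}. \<Oplus>u\<in>D k. F u)"
    by (rule finsum_partition[OF abelian_monoid_axioms F])
  also have "(\<Oplus>j\<in>{0..p - 1}. F (j * q)) = (\<Oplus>j\<in>{..<p}. [(2::nat)] \<cdot> B (w * q * j))"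
  proof (rule finsum_cong')
    show "{0..p - 1} = {..<p}" using p_pos by auto
    fix j assume "j \<in> {..<p}"
    then have "quat_seq p q g h (j * q) = 2" by (intro quat_seq_multiple_q) auto
    then show "F (j * q) = [(2::nat)] \<cdot> B (w * q * j)"
      unfolding F_def by (simp add: add_pow_int_ge mult_ac)
  qed auto
  also have "\<dots> = [(2::nat)] \<cdot> (\<Oplus>j\<in>{..<p}. B (w * q * j))"
    by (rule finsum_nat_pow) auto
  also have "(\<Oplus>j\<in>{1..q - 1}. F (j * p)) = \<zero>"
  proof (rule add.finprod_one_eqI)
    fix j assume "j \<in> {1..q - 1}"
    then have "quat_seq p q g h (j * p) = 0" by (intro quat_seq_multiple_p) auto
    then show "F (j * p) = \<zero>" unfolding F_def by (simp add: add_pow_int_ge)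
  qed
  also have "(\<Oplus>k\<in>{0..3}. \<Oplus>u\<in>D k. F u) = (\<Oplus>k\<in>{0..3}. [k] \<cdot> S w k)"
  proof (rule finsum_cong')
    fix k :: nat assume k: "k \<in> {0..3}"
    have "(\<Oplus>u\<in>D k. F u) = (\<Oplus>u\<in>D k. [k] \<cdot> B (w * u))"
    proof (rule finsum_cong')
      fix u assume "u \<in> D k"
      then have "quat_seq p q g h u = int k" using k by (intro quat_seq_D) auto
      then show "F u = [k] \<cdot> B (w * u)" unfolding F_def by (simp add: add_pow_int_ge)
    qed auto
    also have "\<dots> = [k] \<cdot> S w k" unfolding S_def by (rule finsum_nat_pow) (auto simp: finite_D)
    finally show "(\<Oplus>u\<in>D k. F u) = [k] \<cdot> S w k" .
  qed auto
  finally show ?thesis by simp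
qed

lemma coefficient_closed [simp]: "coefficient i \<in> carrier R"
  unfolding coefficient_eq by (intro a_closed add.nat_pow_closed finsum_closed) auto

text \<open>The weights add up to 0 + 1 + 2 + 3 = 6, which is 2 modulo 4.\<close>

lemma constant_sum:
  assumes x: "x \<in> carrier R" and "\<And>k. k < 4 \<Longrightarrow> S w k = x"
  shows "(\<Oplus>k\<in>{0..3}. [k] \<cdot> S w k) = [(2::nat)] \<cdot> x"
proof -
  have "(\<Oplus>k\<in>{0..3}. [k] \<cdot> S w k) = [(0::nat)] \<cdot> x \<oplus> [(1::nat)] \<cdot> x \<oplus> [(2::nat)] \<cdot> x \<oplus> [(3::nat)] \<cdot> x"
    using assms by (subst finsum_4) auto
  also have "\<dots> = [(6::nat)] \<cdot> x" using x by (simp only: add.nat_pow_mult) simp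
  also have "\<dots> = [(2::nat)] \<cdot> x" using x by (intro nat_mult_mod4) auto
  finally show ?thesis .
qed

text \<open>Since pq - 1 stands for -1, passing from i to w = -i preserves divisibility by p and by
  q.\<close>

lemma dvd_minus_one_mult:
  assumes "r dvd p * q" "r > 1"
  shows "r dvd (p * q - 1) * i \<longleftrightarrow> r dvd i"
proof -
  have "coprime (p * q - 1) (p * q)" using T_pos by (metis coprime_commute coprime_diff_one_left_nat coprime_diff_one_right_nat)
  then have "coprime r (p * q - 1)" using assms(1) by (metis coprime_commute coprime_divisors dvd_refl)
  then show ?thesis by (simp add: coprime_dvd_mult_right_iff)
qed

text \<open>These quarters are the multiplicities m fed into \<open>S_residue\<close>.\<close>

lemma odd_quarter:
  assumes "[r = 5] (mod 8)"
  shows "odd ((r - 1) div 4 :: nat)"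
proof -
  have "r mod 8 = 5" using assms by (simp add: cong_def)
  then obtain m where "r = 8 * m + 5" by (metis mult_div_mod_eq)
  then have "(r - 1) div 4 = 2 * m + 1" by simp
  then show ?thesis by simp
qed

text \<open>After doubling only the parity of the multiplicity survives, and the sign disappears
  because 2 = -2.\<close>

lemma two_odd_mult:
  assumes "odd (m :: nat)"
  shows "[(2::nat)] \<cdot> ([m] \<cdot> \<one>) = [(2::nat)] \<cdot> \<one>" "[(2::nat)] \<cdot> ([m] \<cdot> (\<ominus> \<one>)) = [(2::nat)] \<cdot> \<one>"
proof -
  obtain l where "m = 2 * l + 1" using assms by (rule oddE)
  then have m: "(m * 2) mod (4::nat) = 2 mod 4" by presburger
  have *: "[(2::nat)] \<cdot> ([m] \<cdot> x) = [(2::nat)] \<cdot> x" if "x \<in> carrier R" for x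
    using nat_mult_mod4[OF that m] that by (simp add: add.nat_pow_pow)
  have "\<ominus> \<one> \<oplus> \<ominus> \<one> = \<one> \<oplus> \<one>"
    using four_zero[OF one_closed] by (metis add.inv_equality add.m_closed minus_add one_closed)
  then have "[(2::nat)] \<cdot> (\<ominus> \<one>) = [(2::nat)] \<cdot> \<one>" by (simp add: numeral_2_eq_2)
  then show "[(2::nat)] \<cdot> ([m] \<cdot> \<one>) = [(2::nat)] \<cdot> \<one>" "[(2::nat)] \<cdot> ([m] \<cdot> (\<ominus> \<one>)) = [(2::nat)] \<cdot> \<one>"
    using *[of \<one>] *[of "\<ominus> \<one>"] by simp_all
qed

text \<open>If p divides w, all p terms are 1 and p is odd; otherwise the terms are the powers of a
  nontrivial p-th root of unity and cancel.\<close>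

lemma first_sum:
  "[(2::nat)] \<cdot> (\<Oplus>j\<in>{..<p}. B (w * q * j)) = (if p dvd w then [(2::nat)] \<cdot> \<one> else \<zero>)"
proof (cases "p dvd w")
  case True
  then have "B (w * q * j) = \<one>" for j by (simp add: B_eq_1 mult_dvd_mono)
  then have "(\<Oplus>j\<in>{..<p}. B (w * q * j)) = [p] \<cdot> \<one>" by (simp add: add.finprod_const)
  then show ?thesis using True two_odd_mult(1)[OF odd_p] by simp
next
  case False
  then have "\<not> p * q dvd w * q" using q_pos by simp
  then have "(\<Oplus>j\<in>{..<p}. B (w * q * j)) = \<zero>"
    using odd_p by (intro B_sum_zero) (auto simp: mult_ac)
  then show ?thesis using False by simp
qed

text \<open>The 2 has different sources. At index 0 it comes from the first sum, since each class
  sum equals the even number e and contributes 0 after doubling. At the other indices the first sum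
  vanishes and the class sums give 2.\<close>

lemma coefficient_Q:
  assumes "j \<le> p - 1"
  shows "coefficient (j * q) = [(2::nat)] \<cdot> \<one>"
proof (cases "j = 0")
  case True
  have "even e" using odd_quarter[OF p_mod] odd_q e_eq(1) by simp
  then have e2: "(e * 2) mod 4 = 0 mod 4" by auto
  have "S 0 k = [e] \<cdot> \<one>" if "k < 4" for k
    unfolding S_def using card_D[OF that] B_eq_1[of 0] by (simp add: add.finprod_const)
  then have "(\<Oplus>k\<in>{0..3}. [k] \<cdot> S 0 k) = [(2::nat)] \<cdot> ([e] \<cdot> \<one>)"
    by (intro constant_sum) auto
  also have "\<dots> = \<zero>" using nat_mult_mod4[OF one_closed e2] by (simp add: add.nat_pow_pow)
  finally show ?thesis using True first_sum[of 0] by (simp add: coefficient_eq)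
next
  case False
  let ?w = "(p * q - 1) * (j * q)"
  have nd: "\<not> p dvd ?w"
  proof -
    have "\<not> p dvd j" using False assms p_pos by (auto dest: dvd_imp_le)
    then have "\<not> p dvd j * q" using coprime_pq by (simp add: coprime_dvd_mult_left_iff)
    then show ?thesis using dvd_minus_one_mult[of p] p_pos by simp
  qed
  have "S ?w k = [((q - 1) div 4)] \<cdot> (\<ominus> \<one>)" if "k < 4" for k
  proof (rule S_residue[OF prime_p primroot_p odd_p coprime_H(1) e_eq(2) _ _ that])
    show "\<not> p * q dvd ?w" using nd dvd_mult_left by blast
    show "p * q dvd ?w * p" by (simp add: mult_ac)
  qed
  then have "(\<Oplus>k\<in>{0..3}. [k] \<cdot> S ?w k) = [(2::nat)] \<cdot> ([((q - 1) div 4)] \<cdot> (\<ominus> \<one>))"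
    by (intro constant_sum) auto
  then show ?thesis
    using first_sum[of ?w] nd two_odd_mult(2)[OF odd_quarter[OF q_mod]] by (simp add: coefficient_eq)
qed

text \<open>Here the first sum and the class sums each contribute 2, and 4 = 0.\<close>

lemma coefficient_P:
  assumes "1 \<le> j" "j \<le> q - 1"
  shows "coefficient (j * p) = \<zero>"
proof -
  let ?w = "(p * q - 1) * (j * p)"
  have nd: "\<not> q dvd ?w" using not_dvd_multiple[OF assms] dvd_minus_one_mult[of q] q_pos by simp
  have "S ?w k = [((p - 1) div 4)] \<cdot> (\<ominus> \<one>)" if "k < 4" for k
  proof (rule S_residue[OF prime_q primroot_q odd_q coprime_H(2) e_eq(1) _ _ that])
    show "\<not> p * q dvd ?w" using nd dvd_mult_right by blast
    show "p * q dvd ?w * q" by (simp add: mult_ac)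
  qed
  then have "(\<Oplus>k\<in>{0..3}. [k] \<cdot> S ?w k) = [(2::nat)] \<cdot> ([((p - 1) div 4)] \<cdot> (\<ominus> \<one>))"
    by (intro constant_sum) auto
  then have "coefficient (j * p) = [(2::nat)] \<cdot> \<one> \<oplus> [(2::nat)] \<cdot> \<one>"
    using first_sum[of ?w] two_odd_mult(2)[OF odd_quarter[OF p_mod]] by (simp add: coefficient_eq)
  also have "\<dots> = \<zero>" using four_zero[OF one_closed] by (simp add: numeral_2_eq_2)
  finally show ?thesis .
qed

text \<open>As -1 lies in D 0, the exponent w = -i stays in the class of i; the first sum vanishes
  because p does not divide w.\<close>

lemma coefficient_D:
  assumes "i \<in> D j" "j < 4"
  shows "coefficient i = \<rho> \<ominus> [j] \<cdot> \<one>"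
proof -
  let ?w = "(p * q - 1) * i"
  have w: "?w mod (p * q) \<in> D j"
    using D_mult[OF minus_one_D[OF p_mod q_mod] assms(1)] assms(2) by simp
  have "\<not> p dvd ?w" using D_not_dvd(1)[OF assms(1)] dvd_minus_one_mult[of p] p_pos by simp
  then have "coefficient i = (\<Oplus>k\<in>{0..3}. [k] \<cdot> S ?w k)"
    using first_sum[of ?w] by (simp add: coefficient_eq)
  also have "\<dots> = (\<Oplus>k\<in>{0..3}. [k] \<cdot> S 1 ((j + k) mod 4))"
    using S_unit[OF w] by (intro finsum_cong') auto
  finally show ?thesis using shifted_sum[OF assms(2)] by simp
qed

section \<open>Assembling the polynomial and identifying \<rho>\<close>

lemma mattson_solomon_eq:
  "mattson_solomon R (p * q) (quat_seq p q g h) \<beta> =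
    [(2::nat)] \<cdot>\<^bsub>UP R\<^esub> (\<Oplus>\<^bsub>UP R\<^esub>j\<in>{0..p - 1}. monom (UP R) \<one> (j * q))
    \<oplus>\<^bsub>UP R\<^esub> (\<Oplus>\<^bsub>UP R\<^esub>k\<in>{0..3}. (\<rho> \<ominus> [k] \<cdot> \<one>) \<odot>\<^bsub>UP R\<^esub> set_poly R (D k))"
proof -
  interpret UP_cring R "UP R" by (simp add: UP_cring_def cring_axioms)
  have am: "abelian_monoid (UP R)" using P.abelian_monoid_axioms .
  define F where "F i = monom (UP R) (coefficient i) i" for i
  have F: "F i \<in> carrier (UP R)" for i unfolding F_def by simp
  have "mattson_solomon R (p * q) (quat_seq p q g h) \<beta> = (\<Oplus>\<^bsub>UP R\<^esub>i\<in>{..<p * q}. F i)"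
    unfolding mattson_solomon_def F_def coefficient_def ..
  also have "\<dots> = (\<Oplus>\<^bsub>UP R\<^esub>j\<in>{0..p - 1}. F (j * q)) \<oplus>\<^bsub>UP R\<^esub> (\<Oplus>\<^bsub>UP R\<^esub>j\<in>{1..q - 1}. F (j * p))
      \<oplus>\<^bsub>UP R\<^esub> (\<Oplus>\<^bsub>UP R\<^esub>k\<in>{0..3}. \<Oplus>\<^bsub>UP R\<^esub>u\<in>D k. F u)"
    by (rule finsum_partition[OF am F])
  also have "(\<Oplus>\<^bsub>UP R\<^esub>j\<in>{0..p - 1}. F (j * q)) =
      (\<Oplus>\<^bsub>UP R\<^esub>j\<in>{0..p - 1}. [(2::nat)] \<cdot>\<^bsub>UP R\<^esub> monom (UP R) \<one> (j * q))"
  proof (rule P.finsum_cong')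
    fix j assume "j \<in> {0..p - 1}"
    then have "F (j * q) = monom (UP R) (\<one> \<oplus> \<one>) (j * q)"
      unfolding F_def by (simp add: coefficient_Q numeral_2_eq_2)
    also have "\<dots> = [(2::nat)] \<cdot>\<^bsub>UP R\<^esub> monom (UP R) \<one> (j * q)"
      by (simp add: numeral_2_eq_2)
    finally show "F (j * q) = [(2::nat)] \<cdot>\<^bsub>UP R\<^esub> monom (UP R) \<one> (j * q)" .
  qed auto
  also have "\<dots> = [(2::nat)] \<cdot>\<^bsub>UP R\<^esub> (\<Oplus>\<^bsub>UP R\<^esub>j\<in>{0..p - 1}. monom (UP R) \<one> (j * q))"
    by (rule P.finsum_nat_pow) auto
  also have "(\<Oplus>\<^bsub>UP R\<^esub>j\<in>{1..q - 1}. F (j * p)) = \<zero>\<^bsub>UP R\<^esub>"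
    by (rule P.add.finprod_one_eqI) (simp add: F_def coefficient_P)
  also have "(\<Oplus>\<^bsub>UP R\<^esub>k\<in>{0..3}. \<Oplus>\<^bsub>UP R\<^esub>u\<in>D k. F u) =
      (\<Oplus>\<^bsub>UP R\<^esub>k\<in>{0..3}. (\<rho> \<ominus> [k] \<cdot> \<one>) \<odot>\<^bsub>UP R\<^esub> set_poly R (D k))"
  proof (rule P.finsum_cong')
    fix k :: nat assume k: "k \<in> {0..3}"
    have "(\<rho> \<ominus> [k] \<cdot> \<one>) \<odot>\<^bsub>UP R\<^esub> set_poly R (D k) =
        (\<Oplus>\<^bsub>UP R\<^esub>u\<in>D k. (\<rho> \<ominus> [k] \<cdot> \<one>) \<odot>\<^bsub>UP R\<^esub> monom (UP R) \<one> u)"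
      unfolding set_poly_def by (rule finsum_smult_ldistr) (auto simp: finite_D)
    also have "\<dots> = (\<Oplus>\<^bsub>UP R\<^esub>u\<in>D k. F u)"
      using k by (intro P.finsum_cong')
        (auto simp: F_def coefficient_D[of _ k] monom_mult_smult[symmetric])
    finally show "(\<Oplus>\<^bsub>UP R\<^esub>u\<in>D k. F u) = (\<rho> \<ominus> [k] \<cdot> \<one>) \<odot>\<^bsub>UP R\<^esub> set_poly R (D k)" ..
  qed (auto simp: set_poly_def intro!: UP_smult_closed P.finsum_closed)
  finally show ?thesis
    by (simp add: P.finsum_closed)
qed

text \<open>Ties the evaluations through which the theorem defines \<rho> to the class sums
  \<open>S 1 k\<close>. The coefficient map is \<open>id\<close> because the class polynomial is
  already taken over R.\<close>

lemma eval_set_poly: "eval R R id \<beta> (set_poly R (D k)) = S 1 k"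
proof -
  note cR = cring_axioms and R_cong = finsum_cong'
  interpret UP_pre_univ_prop R R id "UP R"
    by (simp add: UP_pre_univ_prop_def UP_cring_def ring_hom_cring_def ring_hom_cring_axioms_def
        cring_axioms id_ring_hom)
  interpret ev: ring_hom_cring "UP R" R "eval R R id \<beta>"
    using eval_ring_hom[OF \<beta>_closed] cR UP_cring
    by (simp add: ring_hom_cring_def ring_hom_cring_axioms_def)
  have "eval R R id \<beta> (set_poly R (D k)) = (\<Oplus>u\<in>D k. (eval R R id \<beta> \<circ> monom (UP R) \<one>) u)"
    unfolding set_poly_def by (rule ev.hom_finsum) simp
  also have "\<dots> = S 1 k"
    unfolding S_def using \<beta>_closed
    by (intro R_cong) (auto simp: eval_monom B_def)
  finally show ?thesis .
qed

end

theorem theorem1: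
  fixes p q :: nat and g h :: int and f :: "nat \<Rightarrow> int" and \<beta> :: "(nat \<Rightarrow> int) set"
  defines "R \<equiv> galois_ring4 f"
  defines "D \<equiv> cyc_class p q g h"
  defines "D_at_\<beta> \<equiv> \<lambda>k. eval R R id \<beta> (set_poly R (D k))"
  defines "\<rho> \<equiv> D_at_\<beta> 1 \<oplus>\<^bsub>R\<^esub> [(2::nat)] \<cdot>\<^bsub>R\<^esub> D_at_\<beta> 2 \<oplus>\<^bsub>R\<^esub> [(3::nat)] \<cdot>\<^bsub>R\<^esub> D_at_\<beta> 3"
  assumes "Factorial_Ring.prime p" and "Factorial_Ring.prime q" and "p \<noteq> q"
    and "gcd (p - 1) (q - 1) = 4"
    and "common_primitive_root p q g"
    and "[h = g] (mod int p)" and "[h = 1] (mod int q)"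
    and "galois_modulus (ord (p * q) 2) f"
    and "primitive_unity_root R (p * q) \<beta>"
    and "[p = 5] (mod 8)" and "[q = 5] (mod 8)"
  shows "mattson_solomon R (p * q) (quat_seq p q g h) \<beta> =
    [(2::nat)] \<cdot>\<^bsub>UP R\<^esub> (\<Oplus>\<^bsub>UP R\<^esub>j\<in>{0..p - 1}. monom (UP R) \<one>\<^bsub>R\<^esub> (j * q))
    \<oplus>\<^bsub>UP R\<^esub> (\<Oplus>\<^bsub>UP R\<^esub>k\<in>{0..3}. (\<rho> \<ominus>\<^bsub>R\<^esub> [k] \<cdot>\<^bsub>R\<^esub> \<one>\<^bsub>R\<^esub>) \<odot>\<^bsub>UP R\<^esub> set_poly R (D k))"
proof -
  interpret C: cyclotomic4 p q g h
    by unfold_locales (fact assms)+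
  interpret R: cring R
    unfolding R_def by (rule galois_ring4_cring) fact
  interpret L: local_char4 R
    using galois_ring4_char_and_local[OF \<open>galois_modulus (ord (p * q) 2) f\<close>]
    unfolding R_def[symmetric] by unfold_locales
  have \<beta>: "\<beta> \<in> Units R" "group.ord (units_of R) \<beta> = p * q"
    using \<open>primitive_unity_root R (p * q) \<beta>\<close> by (simp_all add: primitive_unity_root_def)
  interpret U: group "units_of R" by (rule R.units_group)
  \<comment> \<open>The order is taken in the group of units, where powers agree with those in
    R.\<close>
  have "\<beta> [^]\<^bsub>R\<^esub> n = \<one>\<^bsub>R\<^esub> \<longleftrightarrow> p * q dvd n" for n :: nat
  proof -
    have "\<beta> [^]\<^bsub>units_of R\<^esub> n = \<beta> [^]\<^bsub>R\<^esub> n"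
      by (rule R.units_of_pow[OF \<beta>(1)])
    then show ?thesis
      using U.pow_eq_id[of \<beta> n] \<beta> by (simp add: units_of_carrier units_of_one)
  qed
  then interpret M: cyclotomic4_root p q g h R \<beta>
    using \<beta>(1) assms(14,15) by unfold_locales auto
  have D: "D = C.D" unfolding D_def C.D_def ..
  have "\<rho> = M.\<rho>"
    unfolding \<rho>_def D_at_\<beta>_def D M.eval_set_poly M.\<rho>_def ..
  then show ?thesis
    unfolding D using M.mattson_solomon_eq by simp
qed

end
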